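(* Let $f,g_1,\dots,g_p,h_1,\dots,h_q:\mathbb{R}^n\to\mathbb{R}$ be twice continuously differentiable and let $x^*$ be a local minimizer of the problem $$\min\ f(x)\quad\text{s.t.}\quad g_i(x)\le 0,\ i=1,\dots,p,\qquad h_j(x)=0,\ j=1,\dots,q.$$ Suppose that the Mangasarian–Fromovitz constraint qualification (MFCQ) holds at $x^*$. Let $(\lambda^1,\mu^1),(\lambda^2,\mu^2),\dots,(\lambda^m,\mu^m)$ be the vertices of the Lagrange multiplier set $\Lambda(x^* )$. Suppose that there exist real symmetric $n\times n$ matrices $A_1,A_2,A_3$ such that $\{\nabla^2L(x^*,\lambda^i,\mu^i):\ i=1,\dots,m\}$ can be generated by $\{A_1,A_2,A_3\}$ (i.e. there are real numbers $r_{ij}$ with $\nabla^2L(x^*,\lambda^i,\mu^i)=\sum_{j=1}^3 r_{ij}A_j$ for $i=1,\dots,m$) and such that $s_1A_1+s_2A_2+s_3A_3\succ 0$ holds for some $s_1,s_2,s_3\in\mathbb{R}$. Then, for every regular cone $K\subseteq C(x^* )$ with $\dim(K)\ge 3$, there exists $(\lambda,\mu)\in\Lambda(x^* )$ such that $$v^T\nabla^2L(x^*,\lambda,\mu)\,v\ge 0\qquad\text{for all } v\in K.$$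
   Context: Setting: $f,g_i,h_j$ are the twice continuously differentiable data of the nonlinear program $\min f(x)$ s.t. $g_i(x)\le0$ ($i=1,\dots,p$), $h_j(x)=0$ ($j=1,\dots,q$). Lagrangian: $L(x,\lambda,\mu)=f(x)+\sum_{i=1}^p\lambda_ig_i(x)+\sum_{j=1}^q\mu_jh_j(x)$ for $\lambda\in\mathbb{R}^p$, $\mu\in\mathbb{R}^q$; $\nabla_xL$ and $\nabla^2L$ denote its gradient and Hessian with respect to $x$. Active set at a feasible point $\bar x$: $I(\bar x)=\{i\in\{1,\dots,p\}: g_i(\bar x)=0\}$. Lagrange multiplier set at a feasible point $\bar x$: $\Lambda(\bar x)$ is the set of $(\lambda,\mu)\in\mathbb{R}^p\times\mathbb{R}^q$ with $\nabla_xL(\bar x,\lambda,\mu)=0$ and $\lambda_i\ge 0$, $\lambda_ig_i(\bar x)=0$ for $i=1,\dots,p$. It is a closed convex polyhedron; its vertices are its extreme points. MFCQ holds at $\bar x$ if (i) the vectors $\nabla h_j(\bar x)$, $j=1,\dots,q$, are linearly independent, and (ii) there exists $u\in\mathbb{R}^n$ with $\nabla g_i(\bar x)^Tu<0$ for all $i\in I(\bar x)$ and $\nabla h_j(\bar x)^Tu=0$ for $j=1,\dots,q$. Critical cone at $\bar x$: $C(\bar x)=\{v\in\mathbb{R}^n:\ \nabla f(\bar x)^Tv\le 0,\ \nabla g_i(\bar x)^Tv\le 0\ (i\in I(\bar x)),\ \nabla h_j(\bar x)^Tv=0\ (j=1,\dots,q)\}$. A set $K\subseteq\mathbb{R}^n$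 is a cone if $\lambda x\in K$ for all $x\in K$ and $\lambda\ge0$; a cone $K$ is a regular cone if $K\cup(-K)$ is a linear subspace of $\mathbb{R}^n$. $\dim(K)$ is the dimension of the linear span of $K$. $A\succ0$ means that the symmetric matrix $A$ is positive definite. *)

theory Defs
  imports "HOL-Analysis.Analysis"
begin

(* The constraints g_i (i in P) and h_j (j in Q) are indexed by subsets P and Q of two finite
   index types, and not by the full types, because types are never empty: this way the numbers
   card P of inequality constraints and card Q of equality constraints are arbitrary, 0 included.
   Members of the families with an index outside P or Q play no role. *)

definition gradient :: "(real^'n \<Rightarrow> real) \<Rightarrow> real^'n \<Rightarrow> real^'n" where
  "gradient f x = (\<chi> i. frechet_derivative f (at x) (axis i 1))"

definition hessian :: "(real^'n \<Rightarrow> real) \<Rightarrow> real^'n \<Rightarrow> real^'n^'n" where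
  "hessian f x = jacobian (gradient f) (at x)"

definition twice_continuously_differentiable :: "(real^'n \<Rightarrow> real) \<Rightarrow> bool" where
  "twice_continuously_differentiable f \<longleftrightarrow>
     (\<forall>x. f differentiable (at x)) \<and>
     (\<forall>x. gradient f differentiable (at x)) \<and>
     continuous_on UNIV (hessian f)"

definition feasible_set ::
    "('p::finite \<Rightarrow> real^'n \<Rightarrow> real) \<Rightarrow> ('q::finite \<Rightarrow> real^'n \<Rightarrow> real) \<Rightarrow> 'p set \<Rightarrow> 'q set
      \<Rightarrow> (real^'n) set" where
  "feasible_set g h P Q = {x. (\<forall>i\<in>P. g i x \<le> 0) \<and> (\<forall>j\<in>Q. h j x = 0)}"

definition local_minimizer :: "(real^'n \<Rightarrow> real) \<Rightarrow> (real^'n) set \<Rightarrow> real^'n \<Rightarrow> bool" where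
  "local_minimizer f S x \<longleftrightarrow> x \<in> S \<and> (\<exists>e>0. \<forall>y\<in>S \<inter> ball x e. f x \<le> f y)"

definition lagrangian ::
    "(real^'n \<Rightarrow> real) \<Rightarrow> ('p::finite \<Rightarrow> real^'n \<Rightarrow> real) \<Rightarrow> ('q::finite \<Rightarrow> real^'n \<Rightarrow> real)
      \<Rightarrow> 'p set \<Rightarrow> 'q set \<Rightarrow> real^'p \<Rightarrow> real^'q \<Rightarrow> real^'n \<Rightarrow> real" where
  "lagrangian f g h P Q lam mu x =
     f x + (\<Sum>i\<in>P. lam $ i * g i x) + (\<Sum>j\<in>Q. mu $ j * h j x)"

definition active_set :: "('p::finite \<Rightarrow> real^'n \<Rightarrow> real) \<Rightarrow> 'p set \<Rightarrow> real^'n \<Rightarrow> 'p set" where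
  "active_set g P x = {i\<in>P. g i x = 0}"

(* The first two conditions identify R^P and R^Q with coordinate subspaces of real^'p and real^'q;
   they are vacuous if P and Q are UNIV. *)
definition multiplier_set ::
    "(real^'n \<Rightarrow> real) \<Rightarrow> ('p::finite \<Rightarrow> real^'n \<Rightarrow> real) \<Rightarrow> ('q::finite \<Rightarrow> real^'n \<Rightarrow> real)
      \<Rightarrow> 'p set \<Rightarrow> 'q set \<Rightarrow> real^'n \<Rightarrow> ((real^'p) \<times> (real^'q)) set" where
  "multiplier_set f g h P Q x =
     {(lam, mu). (\<forall>i. i \<notin> P \<longrightarrow> lam $ i = 0) \<and> (\<forall>j. j \<notin> Q \<longrightarrow> mu $ j = 0) \<and>
        gradient (lagrangian f g h P Q lam mu) x = 0 \<and>
        (\<forall>i\<in>P. 0 \<le> lam $ i \<and> lam $ i * g i x = 0)}"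

definition MFCQ ::
    "('p::finite \<Rightarrow> real^'n \<Rightarrow> real) \<Rightarrow> ('q::finite \<Rightarrow> real^'n \<Rightarrow> real) \<Rightarrow> 'p set \<Rightarrow> 'q set
      \<Rightarrow> real^'n \<Rightarrow> bool" where
  "MFCQ g h P Q x \<longleftrightarrow>
     inj_on (\<lambda>j. gradient (h j) x) Q \<and> independent ((\<lambda>j. gradient (h j) x) ` Q) \<and>
     (\<exists>u. (\<forall>i\<in>active_set g P x. gradient (g i) x \<bullet> u < 0) \<and>
          (\<forall>j\<in>Q. gradient (h j) x \<bullet> u = 0))"

definition critical_cone ::
    "(real^'n \<Rightarrow> real) \<Rightarrow> ('p::finite \<Rightarrow> real^'n \<Rightarrow> real) \<Rightarrow> ('q::finite \<Rightarrow> real^'n \<Rightarrow> real)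
      \<Rightarrow> 'p set \<Rightarrow> 'q set \<Rightarrow> real^'n \<Rightarrow> (real^'n) set" where
  "critical_cone f g h P Q x =
     {v. gradient f x \<bullet> v \<le> 0 \<and>
         (\<forall>i\<in>active_set g P x. gradient (g i) x \<bullet> v \<le> 0) \<and>
         (\<forall>j\<in>Q. gradient (h j) x \<bullet> v = 0)}"

definition regular_cone :: "(real^'n) set \<Rightarrow> bool" where
  "regular_cone K \<longleftrightarrow> cone K \<and> subspace (K \<union> uminus ` K)"

definition symmetric_matrix :: "real^'n^'n \<Rightarrow> bool" where
  "symmetric_matrix A \<longleftrightarrow> transpose A = A"

definition positive_definite :: "real^'n^'n \<Rightarrow> bool" where
  "positive_definite A \<longleftrightarrow> symmetric_matrix A \<and> (\<forall>v. v \<noteq> 0 \<longrightarrow> v \<bullet> (A *v v) > 0)"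

end

theory Submission
  imports Defs
begin

text \<open>
  Every critical direction \<open>v\<close> admits, by the second-order necessary condition under MFCQ, some
  multiplier in \<open>\<Lambda>\<close> whose Hessian form is nonnegative at \<open>v\<close>; by evenness of quadratic forms this
  extends to all \<open>v\<close> in the subspace \<open>S = K \<union> - K\<close>. To choose the multiplier independently of \<open>v\<close>, note
  that the Hessian forms of \<open>\<Lambda>\<close> are linear functions of \<open>(v\<^sup>T A\<^sub>1 v, v\<^sup>T A\<^sub>2 v, v\<^sup>T A\<^sub>3 v)\<close>. If \<open>dim S \<ge> 3\<close> and
  some combination of the \<open>A\<^sub>i\<close> is positive definite, the range of this map on \<open>S\<close> is a convex cone (a
  theorem of Brickman and Polyak), and a minimax argument on this cone and the polytope \<open>\<Lambda>\<close> concludes.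

  For the convexity of the range, let \<open>c\<close> be the normal of the plane spanned by the images of \<open>x\<close> and
  \<open>y\<close>. The quadratic form belonging to \<open>c\<close> vanishes at \<open>x\<close> and \<open>y\<close>, and within a three-dimensional
  space its zero set minus the origin contains a path from \<open>x\<close> to a multiple of \<open>y\<close>; by the intermediate
  value theorem this path meets the ray through the sum of the images.

  The second-order condition combines a theorem of the alternative with the construction of feasible
  parabolic arcs.
\<close>

section \<open>Joint range of three quadratic forms\<close>

definition quad_form :: "real^'n^'n \<Rightarrow> real^'n \<Rightarrow> real" where
  "quad_form A v = v \<bullet> (A *v v)"

text \<open>The values are placed in \<open>real^3\<close> so that a normal of the plane spanned by
  two images is available as a cross product.\<close>

definition quad_map :: "real^'n^'n \<Rightarrow> real^'n^'n \<Rightarrow> real^'n^'n \<Rightarrow> real^'n \<Rightarrow> real^3" where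
  "quad_map A B C v = vector [quad_form A v, quad_form B v, quad_form C v]"

lemma symmetric_matrix_inner:
  assumes "symmetric_matrix A"
  shows "x \<bullet> (A *v y) = y \<bullet> (A *v x)"
proof -
  have "x v* A = A *v x"
    by (metis assms symmetric_matrix_def vector_transpose_matrix)
  then show ?thesis
    using dot_lmul_matrix[of x A y] by (simp add: inner_commute)
qed

lemma quad_form_add:
  assumes "symmetric_matrix A"
  shows "quad_form A (x + y) = quad_form A x + 2 * (x \<bullet> (A *v y)) + quad_form A y"
  using symmetric_matrix_inner[OF assms, of y x]
  by (simp add: quad_form_def matrix_vector_right_distrib inner_add_left inner_add_right)

lemma quad_form_scale [simp]: "quad_form A (c *\<^sub>R x) = c\<^sup>2 * quad_form A x"
  by (simp add: quad_form_def matrix_vector_mult_scaleR power2_eq_square)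

lemma quad_form_minus [simp]: "quad_form A (- x) = quad_form A x"
  using quad_form_scale[of A "-1" x] by simp

lemma quad_form_add_matrix: "quad_form (A + B) v = quad_form A v + quad_form B v"
  by (simp add: quad_form_def matrix_vector_mult_add_rdistrib inner_add_right)

lemma quad_form_scale_matrix: "quad_form (c *\<^sub>R A) v = c * quad_form A v"
  by (simp add: quad_form_def scaleR_matrix_vector_assoc[symmetric])

lemma quad_form_sum_matrix: "quad_form (sum A I) v = (\<Sum>i\<in>I. quad_form (A i) v)"
  by (induction I rule: infinite_finite_induct)
    (simp_all add: quad_form_add_matrix quad_form_scale_matrix[of 0, simplified])

lemma continuous_on_quad_form [continuous_intros]:
  assumes "continuous_on T f"
  shows "continuous_on T (\<lambda>x. quad_form A (f x))"
  unfolding quad_form_def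
  by (intro continuous_on_inner assms
      bounded_linear.continuous_on[OF matrix_vector_mul_bounded_linear])

text \<open>This turns linear functionals on the joint range into single members of the pencil of
  the three matrices.\<close>

lemma inner_quad_map:
  "c \<bullet> quad_map A B C v = quad_form (c$1 *\<^sub>R A + c$2 *\<^sub>R B + c$3 *\<^sub>R C) v"
  by (simp add: quad_map_def inner_vec_def sum_3 vector_3 quad_form_add_matrix quad_form_scale_matrix)

lemma quad_map_scale: "quad_map A B C (c *\<^sub>R v) = c\<^sup>2 *\<^sub>R quad_map A B C v"
  by (simp add: quad_map_def vec_eq_iff forall_3 vector_3)

lemma symmetric_matrix_add: "symmetric_matrix A \<Longrightarrow> symmetric_matrix B \<Longrightarrow> symmetric_matrix (A + B)"
  by (simp add: symmetric_matrix_def transpose_def vec_eq_iff)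

lemma symmetric_matrix_scale: "symmetric_matrix A \<Longrightarrow> symmetric_matrix (c *\<^sub>R A)"
  by (simp add: symmetric_matrix_def transpose_def vec_eq_iff)

section \<open>Isotropic vectors and additivity of the joint range\<close>

lemma sign_change_on_arc:
  fixes p :: "real \<Rightarrow> real^'n"
  assumes "continuous_on {0..1} p" "quad_form D (p 0) * quad_form D (p 1) < 0"
  obtains s where "0 < s" "s < 1" "quad_form D (p s) = 0"
proof -
  have c: "continuous_on {0..1} (\<lambda>s. quad_form D (p s))"
    using assms(1) by (intro continuous_intros)
  obtain s where "0 \<le> s" "s \<le> 1" "quad_form D (p s) = 0"
  proof (cases "quad_form D (p 0) < 0")
    case True
    then have "quad_form D (p 1) > 0" using assms(2) by (simp add: mult_less_0_iff)
    then show ?thesis using IVT'[of "\<lambda>s. quad_form D (p s)" 0 0 1] True c that by force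
  next
    case False
    then have "quad_form D (p 0) > 0" "quad_form D (p 1) < 0" using assms(2) by (auto simp: mult_less_0_iff)
    then show ?thesis using IVT2'[of "\<lambda>s. quad_form D (p s)" 1 0 0] c that by force
  qed
  moreover from this have "s \<noteq> 0" "s \<noteq> 1" using assms(2) by auto
  ultimately show ?thesis using that[of s] by simp
qed

text \<open>The zero set of \<open>C\<close> contains an arc that avoids the origin and whose
  endpoints give \<open>D\<close> opposite signs. If \<open>C\<close> is hyperbolic on the plane of
  \<open>x\<close> and \<open>y\<close>, its zero set there is just two lines, and \<open>z\<close>
  supplies the dimension in which the arc can leave them.\<close>

lemma common_isotropic_vector:
  fixes C D :: "real^'n^'n"
  assumes symC: "symmetric_matrix C" and symD: "symmetric_matrix D"
    and S: "subspace S" "x \<in> S" "y \<in> S" "z \<in> S" and z: "z \<notin> span {x, y}"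
    and Cx: "quad_form C x = 0" and Cy: "quad_form C y = 0"
    and D: "quad_form D x < 0" "0 < quad_form D y"
  obtains v where "v \<in> S" "v \<noteq> 0" "quad_form C v = 0" "quad_form D v = 0"
proof -
  define b where "b = x \<bullet> (C *v y)"
  show ?thesis
  proof (cases "b = 0")
    case True
    \<comment> \<open>Here \<open>C\<close> vanishes on the whole span of \<open>x\<close> and
      \<open>y\<close>, so the segment suffices.\<close>
    define p where "p s = (1 - s) *\<^sub>R x + s *\<^sub>R y" for s
    have "continuous_on {0..1} p" unfolding p_def by (intro continuous_intros)
    moreover have "quad_form D (p 0) * quad_form D (p 1) < 0"
      using D by (simp add: p_def mult_less_0_iff)
    ultimately obtain s where s: "0 < s" "s < 1" "quad_form D (p s) = 0"
      by (rule sign_change_on_arc)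
    \<comment> \<open>A segment through the origin would make \<open>x\<close> and \<open>y\<close>
      parallel, and \<open>D\<close> could not have opposite signs on them.\<close>
    have "p s \<noteq> 0"
    proof
      assume "p s = 0"
      then have "(1 - s) *\<^sub>R x = (- s) *\<^sub>R y" by (simp add: p_def eq_neg_iff_add_eq_0)
      then have "(1 - s)\<^sup>2 * quad_form D x = s\<^sup>2 * quad_form D y"
        by (metis quad_form_scale power2_minus)
      moreover have "(1 - s)\<^sup>2 * quad_form D x < 0" using s D by (simp add: mult_less_0_iff)
      moreover have "s\<^sup>2 * quad_form D y > 0" using s D by simp
      ultimately show False by simp
    qed
    moreover have "quad_form C (p s) = 0"
      using Cx Cy True by (simp add: p_def quad_form_add[OF symC] b_def matrix_vector_mult_scaleR)
    moreover have "p s \<in> S" using S by (simp add: p_def subspace_add subspace_scale)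
    ultimately show ?thesis using that s by blast
  next
    case False
    \<comment> \<open>This is the component of \<open>z\<close> that is \<open>C\<close>-orthogonal
      to \<open>x\<close> and \<open>y\<close>. Both are isotropic, so the coefficient of
      \<open>x\<close> comes from pairing \<open>z\<close> with \<open>y\<close>, and
      conversely.\<close>
    define w where "w = z - (z \<bullet> (C *v y) / b) *\<^sub>R x - (z \<bullet> (C *v x) / b) *\<^sub>R y"
    have yx: "y \<bullet> (C *v x) = b" by (simp add: b_def symmetric_matrix_inner[OF symC, of y x])
    have "w \<bullet> (C *v x) = 0"
      using Cx False by (simp add: w_def inner_diff_left yx flip: quad_form_def)
    then have wx: "x \<bullet> (C *v w) = 0" using symmetric_matrix_inner[OF symC, of x w] by simp
    have "w \<bullet> (C *v y) = 0"
      using Cy False by (simp add: w_def inner_diff_left flip: quad_form_def b_def)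
    then have wy: "y \<bullet> (C *v w) = 0" using symmetric_matrix_inner[OF symC, of y w] by simp
    have wS: "w \<in> S" using S by (simp add: w_def subspace_diff subspace_scale)
    have nz: "\<alpha> *\<^sub>R x + \<beta> *\<^sub>R y + \<gamma> *\<^sub>R w \<noteq> 0" if "\<gamma> \<noteq> 0" for \<alpha> \<beta> \<gamma>
    proof
      assume "\<alpha> *\<^sub>R x + \<beta> *\<^sub>R y + \<gamma> *\<^sub>R w = 0"
      then have "\<gamma> *\<^sub>R w = - \<alpha> *\<^sub>R x - \<beta> *\<^sub>R y"
        by (simp add: algebra_simps eq_neg_iff_add_eq_0)
      then have "w = (1 / \<gamma>) *\<^sub>R (- \<alpha> *\<^sub>R x - \<beta> *\<^sub>R y)"
        using that by (metis scaleR_scaleR divide_self scaleR_one times_divide_eq_left mult_1)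
      then have "w \<in> span {x, y}"
        by (simp add: span_base span_scale span_diff span_neg)
      moreover have "z = w + (z \<bullet> (C *v y) / b) *\<^sub>R x + (z \<bullet> (C *v x) / b) *\<^sub>R y"
        by (simp add: w_def)
      ultimately have "z \<in> span {x, y}"
        by (metis span_add span_scale span_base insertI1 insertI2)
      then show False using z by simp
    qed
    have Cv: "quad_form C (\<alpha> *\<^sub>R x + \<beta> *\<^sub>R y + \<gamma> *\<^sub>R w) = 2 * \<alpha> * \<beta> * b + \<gamma>\<^sup>2 * quad_form C w" for \<alpha> \<beta> \<gamma>
      using Cx Cy wx wy
      by (simp add: quad_form_add[OF symC] matrix_vector_mult_scaleR inner_add_left b_def)
    have vS: "\<alpha> *\<^sub>R x + \<beta> *\<^sub>R y + \<gamma> *\<^sub>R w \<in> S" for \<alpha> \<beta> \<gamma>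
      using S wS by (simp add: subspace_add subspace_scale)
    \<comment> \<open>With this \<open>k\<close> the equation \<open>C = 0\<close> reads
      \<open>\<alpha> \<beta> = k \<gamma>\<^sup>2\<close>. For \<open>k = 0\<close> it degenerates
      into the planes \<open>\<alpha> = 0\<close> and \<open>\<beta> = 0\<close>, and the sign of
      \<open>D\<close> at \<open>w\<close> decides in which of them a segment ending at
      \<open>w\<close> works.\<close>
    define k where "k = - quad_form C w / (2 * b)"
    have Cw: "quad_form C w = - 2 * k * b" using False by (simp add: k_def)
    consider "k \<noteq> 0" | "k = 0" "quad_form D w = 0" | "k = 0" "quad_form D w > 0" | "k = 0" "quad_form D w < 0"
      by linarith
    then show ?thesis
    proof cases
      case 1
      text \<open>The coordinates satisfy \<open>\<alpha> \<beta> = k \<gamma>\<^sup>2\<close>: this rational parametrisation of the conic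
        \<open>C = 0\<close> leads from \<open>x\<close> to \<open>k y\<close>.\<close>
      define p where "p s = (1 - s)\<^sup>2 *\<^sub>R x + (k * s\<^sup>2) *\<^sub>R y + (s * (1 - s)) *\<^sub>R w" for s
      have "continuous_on {0..1} p" unfolding p_def by (intro continuous_intros)
      moreover have "quad_form D (p 0) * quad_form D (p 1) < 0"
        using D 1 by (simp add: p_def mult_less_0_iff zero_less_mult_iff)
      ultimately obtain s where s: "0 < s" "s < 1" "quad_form D (p s) = 0"
        by (rule sign_change_on_arc)
      have "quad_form C (p s) = 0"
        unfolding p_def Cv Cw by (simp add: power2_eq_square algebra_simps)
      moreover have "p s \<noteq> 0" unfolding p_def by (rule nz) (use s in auto)
      moreover have "p s \<in> S" unfolding p_def by (rule vS)
      ultimately show ?thesis using that s by blast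
    next
      case 2
      then show ?thesis using that[of w] wS nz[of 1 0 0] Cw by simp
    next
      case 3
      \<comment> \<open>The zero coefficient stays explicit so that \<open>nz\<close>,
        \<open>Cv\<close> and \<open>vS\<close> match.\<close>
      define p where "p s = (1 - s) *\<^sub>R x + 0 *\<^sub>R y + s *\<^sub>R w" for s
      have "continuous_on {0..1} p" unfolding p_def by (intro continuous_intros)
      moreover have "quad_form D (p 0) * quad_form D (p 1) < 0"
        using D 3 by (simp add: p_def mult_less_0_iff)
      ultimately obtain s where s: "0 < s" "s < 1" "quad_form D (p s) = 0"
        by (rule sign_change_on_arc)
      have "quad_form C (p s) = 0" unfolding p_def Cv Cw using 3 by simp
      moreover have "p s \<noteq> 0" unfolding p_def by (rule nz) (use s in auto)
      moreover have "p s \<in> S" unfolding p_def by (rule vS)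
      ultimately show ?thesis using that s by blast
    next
      case 4
      define p where "p s = 0 *\<^sub>R x + (1 - s) *\<^sub>R y + s *\<^sub>R w" for s
      have "continuous_on {0..1} p" unfolding p_def by (intro continuous_intros)
      moreover have "quad_form D (p 0) * quad_form D (p 1) < 0"
        using D 4 by (simp add: p_def mult_less_0_iff)
      ultimately obtain s where s: "0 < s" "s < 1" "quad_form D (p s) = 0"
        by (rule sign_change_on_arc)
      have "quad_form C (p s) = 0" unfolding p_def Cv Cw using 4 by simp
      moreover have "p s \<noteq> 0" unfolding p_def by (rule nz) (use s in auto)
      moreover have "p s \<in> S" unfolding p_def by (rule vS)
      ultimately show ?thesis using that s by blast
    qed
  qed
qed

text \<open>Only the line through the sum has to be hit: the definite combination forces the
  multiple to be positive, and rescaling removes it. That line is cut out by two linear equations,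
  one for the plane of the images and one for the line inside it.\<close>

lemma quad_map_range_add:
  fixes A1 A2 A3 :: "real^'n^'n"
  assumes sym: "symmetric_matrix A1" "symmetric_matrix A2" "symmetric_matrix A3"
    and pd: "positive_definite (s1 *\<^sub>R A1 + s2 *\<^sub>R A2 + s3 *\<^sub>R A3)"
    and S: "subspace S" "3 \<le> dim S" "x \<in> S" "y \<in> S"
  shows "\<exists>v\<in>S. quad_map A1 A2 A3 v = quad_map A1 A2 A3 x + quad_map A1 A2 A3 y"
proof -
  let ?Q = "quad_map A1 A2 A3"
  define s :: "real^3" where "s = vector [s1, s2, s3]"
  have pos: "s \<bullet> ?Q v > 0" if "v \<noteq> 0" for v
    using pd that by (simp add: inner_quad_map s_def vector_3 positive_definite_def quad_form_def)
  have Q0: "?Q 0 = 0" using quad_map_scale[of A1 A2 A3 0 0] by simp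
  define e where "e = ?Q x + ?Q y"
  have parallel: ?thesis if "?Q v = \<tau> *\<^sub>R e" "v \<in> S" "v \<noteq> 0" "e \<noteq> 0" for v \<tau>
  proof -
    have "s \<bullet> e = s \<bullet> ?Q x + s \<bullet> ?Q y" by (simp add: e_def inner_add_right)
    moreover have "s \<bullet> ?Q x \<ge> 0" "s \<bullet> ?Q y \<ge> 0"
      using pos[of x] pos[of y] Q0 by (cases "x = 0"; cases "y = 0"; simp)+
    ultimately have "s \<bullet> e \<ge> 0" by simp
    moreover have "\<tau> * (s \<bullet> e) > 0" using pos[OF that(3)] that(1) by simp
    ultimately have "\<tau> > 0" by (simp add: zero_less_mult_iff)
    then have "?Q ((1 / sqrt \<tau>) *\<^sub>R v) = e"
      using that by (simp add: quad_map_scale power_divide)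
    then show ?thesis using S that by (metis e_def subspace_scale)
  qed
  define c where "c = cross3 (?Q x) (?Q y)"
  consider "x = 0" | "y = 0" | "c = 0" "x \<noteq> 0" "y \<noteq> 0" | "c \<noteq> 0" by blast
  then show ?thesis
  proof cases
    case 1
    then show ?thesis using S Q0 by auto
  next
    case 2
    then show ?thesis using S Q0 by auto
  next
    case 3
    \<comment> \<open>The images are parallel, so \<open>x\<close> itself already maps to a multiple
      of the sum.\<close>
    have e0: "e \<noteq> 0" using pos[OF 3(2)] pos[OF 3(3)] unfolding e_def
      by (metis add_pos_pos inner_add_right inner_zero_right less_irrefl)
    have "cross3 (?Q x) e = 0" using 3 by (simp add: e_def cross_add_right c_def)
    then have "collinear {0, e, ?Q x}" using cross_skew[of e "?Q x"] by (simp flip: cross_eq_0)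
    then obtain \<tau> where "?Q x = \<tau> *\<^sub>R e" using e0 by (auto simp: collinear_lemma)
    then show ?thesis by (rule parallel[OF _ S(3) 3(2) e0])
  next
    case 4
    \<comment> \<open>Inside the plane of the images \<open>d\<close> is normal to \<open>e\<close>.
      The two images lie on different sides of \<open>e\<close>, which gives the form of
      \<open>d\<close> opposite signs at \<open>x\<close> and \<open>y\<close>.\<close>
    define d where "d = cross3 c e"
    have cx: "c \<bullet> ?Q x = 0" and cy: "c \<bullet> ?Q y = 0"
      by (simp_all add: c_def dot_cross_self inner_commute[of "cross3 _ _"])
    have ce: "c \<bullet> e = 0" by (simp add: e_def inner_add_right cx cy)
    have e0: "e \<noteq> 0"
    proof
      assume "e = 0"
      then have "?Q y = - ?Q x" by (simp add: e_def eq_neg_iff_add_eq_0 add.commute)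
      then show False using 4 by (simp add: c_def)
    qed
    have "d \<bullet> ?Q x = c \<bullet> (cross3 e (?Q x))" by (metis d_def cross_triple inner_commute)
    also have "cross3 e (?Q x) = - c" unfolding e_def c_def cross_add_left by (simp add: cross_skew[of "?Q y"])
    finally have dx: "d \<bullet> ?Q x < 0" using 4 by simp
    have "d \<bullet> ?Q y = c \<bullet> (cross3 e (?Q y))" by (metis d_def cross_triple inner_commute)
    also have "cross3 e (?Q y) = c" unfolding e_def c_def cross_add_left by simp
    finally have dy: "d \<bullet> ?Q y > 0" using 4 by simp
    have "\<not> S \<subseteq> span {x, y}"
    proof
      assume "S \<subseteq> span {x, y}"
      then have "dim S \<le> card {x, y}" by (intro dim_le_card) auto
      also have "\<dots> \<le> 2" by (simp add: card_insert_if)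
      finally show False using S by simp
    qed
    then obtain z where z: "z \<in> S" "z \<notin> span {x, y}" by blast
    define C where "C = c$1 *\<^sub>R A1 + c$2 *\<^sub>R A2 + c$3 *\<^sub>R A3"
    define D where "D = d$1 *\<^sub>R A1 + d$2 *\<^sub>R A2 + d$3 *\<^sub>R A3"
    have "symmetric_matrix C" "symmetric_matrix D"
      unfolding C_def D_def by (intro symmetric_matrix_add symmetric_matrix_scale sym)+
    then obtain v where v: "v \<in> S" "v \<noteq> 0" "quad_form C v = 0" "quad_form D v = 0"
      using common_isotropic_vector[of C D S x y z] S z cx cy dx dy
      unfolding inner_quad_map C_def[symmetric] D_def[symmetric] by blast
    have cv: "c \<bullet> ?Q v = 0" and dv: "d \<bullet> ?Q v = 0" using v by (simp_all add: inner_quad_map C_def D_def)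
    \<comment> \<open>Vectors orthogonal to both \<open>c\<close> and \<open>d\<close> are parallel
      to their cross product, which is a multiple of \<open>e\<close>.\<close>
    have "cross3 d c = (c \<bullet> c) *\<^sub>R e"
      unfolding d_def by (subst cross_skew) (simp add: Lagrange ce)
    moreover have "cross3 (?Q v) (cross3 d c) = 0"
      by (simp add: Lagrange cv dv inner_commute[of "?Q v"])
    ultimately have "cross3 (?Q v) e = 0" using 4 by (simp add: cross_mult_right)
    then have "collinear {0, e, ?Q v}" using cross_skew[of e "?Q v"] by (simp flip: cross_eq_0)
    then obtain \<tau> where "?Q v = \<tau> *\<^sub>R e" using e0 by (auto simp: collinear_lemma)
    then show ?thesis by (rule parallel[OF _ v(1,2) e0])
  qed
qed

text \<open>Homogeneity of degree two makes the range a cone, and for a cone closure under addition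
  amounts to convexity.\<close>

lemma convex_cone_quad_map_range:
  assumes "symmetric_matrix A1" "symmetric_matrix A2" "symmetric_matrix A3"
    and "positive_definite (s1 *\<^sub>R A1 + s2 *\<^sub>R A2 + s3 *\<^sub>R A3)"
    and "subspace S" "3 \<le> dim S"
  shows "convex (quad_map A1 A2 A3 ` S)" "cone (quad_map A1 A2 A3 ` S)"
proof -
  show cn: "cone (quad_map A1 A2 A3 ` S)"
    unfolding cone_def
  proof (intro ballI allI impI)
    fix w and c :: real assume "w \<in> quad_map A1 A2 A3 ` S" "0 \<le> c"
    then obtain v where "v \<in> S" "w = quad_map A1 A2 A3 v" by blast
    then have "c *\<^sub>R w = quad_map A1 A2 A3 (sqrt c *\<^sub>R v)" "sqrt c *\<^sub>R v \<in> S"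
      using \<open>0 \<le> c\<close> assms by (auto simp: quad_map_scale subspace_scale)
    then show "c *\<^sub>R w \<in> quad_map A1 A2 A3 ` S" by blast
  qed
  show "convex (quad_map A1 A2 A3 ` S)"
  proof -
    have "quad_map A1 A2 A3 x + quad_map A1 A2 A3 y \<in> quad_map A1 A2 A3 ` S"
      if "x \<in> S" "y \<in> S" for x y
      using quad_map_range_add[OF assms that] by (metis imageI)
    then have "\<forall>w\<in>quad_map A1 A2 A3 ` S. \<forall>w'\<in>quad_map A1 A2 A3 ` S. w + w' \<in> quad_map A1 A2 A3 ` S"
      by blast
    then show ?thesis using cn convex_cone[of "quad_map A1 A2 A3 ` S"] by (auto simp: cone_def)
  qed
qed

section \<open>Minimax for convex cones\<close>

text \<open>The failure of the conclusion separates \<open>R\<close> from the dual cone of \<open>W\<close>, and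
  the separating functional lies in the closure of \<open>W\<close> by the bipolar theorem.\<close>

lemma compact_convex_cone_minimax:
  fixes R W :: "'a::euclidean_space set"
  assumes R: "convex R" "compact R" and W: "convex W" "cone W" "W \<noteq> {}"
    and ex: "\<And>w. w \<in> W \<Longrightarrow> \<exists>r\<in>R. 0 \<le> r \<bullet> w"
  shows "\<exists>r\<in>R. \<forall>w\<in>W. 0 \<le> r \<bullet> w"
proof (rule ccontr)
  assume no: "\<not> ?thesis"
  define P where "P = {r. \<forall>w\<in>W. 0 \<le> r \<bullet> w}"
  have "P = (\<Inter>w\<in>W. {r. 0 \<le> w \<bullet> r})" by (auto simp: P_def inner_commute)
  then have "closed P" "convex P"
    by (auto intro!: closed_halfspace_ge convex_INT convex_halfspace_ge closed_INT)
  moreover have "R \<noteq> {}" using W ex by blast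
  moreover have "R \<inter> P = {}" using no by (auto simp: P_def)
  ultimately obtain a b where a: "\<And>r. r \<in> R \<Longrightarrow> a \<bullet> r < b" "\<And>r. r \<in> P \<Longrightarrow> b < a \<bullet> r"
    using separating_hyperplane_compact_closed[of R P] R by blast
  have "0 \<in> P" by (simp add: P_def)
  then have b: "b < 0" using a(2) by fastforce
  have "a \<in> closure W"
  proof (rule ccontr)
    assume "a \<notin> closure W"
    then obtain r t where r: "r \<bullet> a < t" "\<And>w. w \<in> closure W \<Longrightarrow> t < r \<bullet> w"
      using separating_hyperplane_closed_point[of "closure W" a] W by (auto simp: convex_closure)
    have rw: "0 \<le> r \<bullet> w" if "w \<in> W" for w
    proof (rule ccontr)
      assume neg: "\<not> 0 \<le> r \<bullet> w"
      \<comment> \<open>Chosen so that the inner product of \<open>r\<close> with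
        \<open>c *\<^sub>R w\<close> is \<open>- \<bar>t\<bar>\<close>, which cannot exceed
        \<open>t\<close>.\<close>
      define c where "c = \<bar>t\<bar> / - (r \<bullet> w)"
      have "c \<ge> 0" unfolding c_def using neg by (intro divide_nonneg_nonneg) auto
      then have "c *\<^sub>R w \<in> W" using W that by (simp add: cone_def)
      then have "t < r \<bullet> (c *\<^sub>R w)" using r(2) closure_subset by blast
      then show False using neg by (simp add: c_def)
    qed
    have "0 \<in> W" using W by (simp add: cone_contains_0)
    then have "t < 0" using r(2)[of 0] closure_subset by auto
    then have ra: "r \<bullet> a < 0" using r(1) by simp
    \<comment> \<open>Scales \<open>r\<close> within \<open>P\<close> so that its inner product with
      \<open>a\<close> is \<open>2 * b\<close>, below the negative bound \<open>b\<close>.\<close>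
    define c where "c = 2 * b / (r \<bullet> a)"
    have "c \<ge> 0" unfolding c_def using b ra by (intro divide_nonpos_neg) auto
    then have "c *\<^sub>R r \<in> P" using rw by (simp add: P_def)
    then have "b < c * (r \<bullet> a)" using a(2)[of "c *\<^sub>R r"] by (simp add: inner_commute)
    then show False using b ra by (simp add: c_def)
  qed
  \<comment> \<open>\<open>W\<close> may fail to be closed, so \<open>a\<close> is approximated from
    inside \<open>W\<close>. Boundedness of \<open>R\<close> makes the error smaller than the gap
    \<open>- b\<close> uniformly on \<open>R\<close>.\<close>
  then obtain X where X: "\<And>n. X n \<in> W" "X \<longlonglongrightarrow> a"
    by (auto simp: closure_sequential)
  obtain M where M: "M > 0" "\<And>r. r \<in> R \<Longrightarrow> norm r \<le> M"
    using compact_imp_bounded[OF R(2)] by (auto simp: bounded_pos)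
  have "\<forall>\<^sub>F n in sequentially. dist (X n) a < - b / M"
    using X(2) b M by (intro tendstoD) (auto intro: divide_neg_pos)
  then obtain n where n: "dist (X n) a < - b / M" by (meson eventually_happens trivial_limit_sequentially)
  obtain r where r: "r \<in> R" "0 \<le> r \<bullet> X n" using ex X by blast
  have "r \<bullet> X n = a \<bullet> r + r \<bullet> (X n - a)" by (simp add: inner_diff_right inner_commute)
  also have "r \<bullet> (X n - a) \<le> norm r * norm (X n - a)" by (rule norm_cauchy_schwarz)
  also have "\<dots> \<le> M * (- b / M)"
    using M r n by (intro mult_mono) (auto simp: dist_norm)
  also have "\<dots> = - b" using M by simp
  finally show False using a(1)[OF r(1)] r(2) by simp
qed

section \<open>Gradients, Hessians and Taylor expansion\<close>

lemma gradient_eqI: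
  fixes f :: "real^'n \<Rightarrow> real"
  assumes "(f has_derivative (\<lambda>h. a \<bullet> h)) (at x)"
  shows "gradient f x = a"
  by (simp add: gradient_def frechet_derivative_at[OF assms, symmetric] inner_axis)

lemma has_derivative_gradient:
  fixes f :: "real^'n \<Rightarrow> real"
  assumes "f differentiable (at x)"
  shows "(f has_derivative (\<lambda>h. gradient f x \<bullet> h)) (at x)"
proof -
  let ?D = "frechet_derivative f (at x)"
  have D: "(f has_derivative ?D) (at x)" using assms by (simp flip: frechet_derivative_works)
  then have lin: "linear ?D" by (rule has_derivative_linear)
  have "?D h = gradient f x \<bullet> h" for h
  proof -
    have "?D h = ?D (\<Sum>i\<in>UNIV. h $ i *\<^sub>R axis i 1)"
      using basis_expansion[of h] by (simp add: scalar_mult_eq_scaleR)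
    also have "\<dots> = (\<Sum>i\<in>UNIV. h $ i * ?D (axis i 1))"
      by (simp add: linear_sum[OF lin] linear_scale[OF lin])
    finally show ?thesis by (simp add: gradient_def inner_vec_def mult.commute)
  qed
  then show ?thesis using D by presburger
qed

lemma has_derivative_hessian:
  assumes "gradient f differentiable (at x)"
  shows "(gradient f has_derivative (\<lambda>h. hessian f x *v h)) (at x)"
  using assms by (simp add: hessian_def flip: jacobian_works)

lemma hessian_eqI:
  assumes "(gradient f has_derivative (\<lambda>h. A *v h)) (at x)"
  shows "hessian f x = A"
  by (simp add: hessian_def jacobian_def frechet_derivative_at[OF assms, symmetric]
      matrix_of_matrix_vector_mul)

lemma sum_matrix_vector_mult: "sum A I *v x = (\<Sum>i\<in>I. A i *v x)"
  for A :: "'i \<Rightarrow> real^'n^'m"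
  by (induction I rule: infinite_finite_induct) (simp_all add: matrix_vector_mult_add_rdistrib)

text \<open>The mean value theorem along the segment from \<open>x\<close> to \<open>x + y\<close>
  reduces the remainder to the error in linearizing the gradient at \<open>x\<close>.\<close>

lemma second_order_taylor:
  fixes f :: "real^'n \<Rightarrow> real"
  assumes f: "\<And>x. f differentiable (at x)" "gradient f differentiable (at x)" and "e > 0"
  obtains d where "d > 0"
    "\<And>y. norm y < d \<Longrightarrow>
      \<bar>f (x + y) - f x - gradient f x \<bullet> y - quad_form (hessian f x) y / 2\<bar> \<le> e * (norm y)\<^sup>2"
proof -
  obtain d where d: "d > 0" "\<And>y. norm (y - x) < d \<Longrightarrow>
      norm (gradient f y - gradient f x - hessian f x *v (y - x)) \<le> e * norm (y - x)"
    using has_derivative_hessian[OF f(2)] \<open>e > 0\<close> unfolding has_derivative_at_alt by blast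
  have "\<bar>f (x + y) - f x - gradient f x \<bullet> y - quad_form (hessian f x) y / 2\<bar> \<le> e * (norm y)\<^sup>2"
    if "norm y < d" for y
  proof -
    let ?q = "quad_form (hessian f x) y"
    define \<theta> where "\<theta> s = f (x + s *\<^sub>R y) - s * (gradient f x \<bullet> y) - s\<^sup>2 / 2 * ?q" for s
    have D: "DERIV \<theta> s :> gradient f (x + s *\<^sub>R y) \<bullet> y - gradient f x \<bullet> y - s * ?q" for s
    proof -
      have "((\<lambda>s. f (x + s *\<^sub>R y)) has_derivative (\<lambda>c. gradient f (x + s *\<^sub>R y) \<bullet> (c *\<^sub>R y))) (at s)"
        by (rule has_derivative_compose[OF _ has_derivative_gradient[OF f(1)]])
          (auto intro!: derivative_eq_intros)
      then have "DERIV (\<lambda>s. f (x + s *\<^sub>R y)) s :> gradient f (x + s *\<^sub>R y) \<bullet> y"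
        by (simp add: has_field_derivative_def mult.commute[of _ "gradient f (x + s *\<^sub>R y) \<bullet> y"])
      then show ?thesis unfolding \<theta>_def by (auto intro!: derivative_eq_intros)
    qed
    obtain z where z: "0 < z" "z < 1"
      "\<theta> 1 - \<theta> 0 = (1 - 0) * (gradient f (x + z *\<^sub>R y) \<bullet> y - gradient f x \<bullet> y - z * ?q)"
      using MVT2[of 0 1 \<theta>, OF _ D] by auto
    have zy: "norm (z *\<^sub>R y) \<le> norm y" using z by (simp add: mult_left_le_one_le)
    have "\<theta> 1 - \<theta> 0 = (gradient f (x + z *\<^sub>R y) - gradient f x - hessian f x *v (z *\<^sub>R y)) \<bullet> y"
      using z by (simp add: inner_diff_left inner_diff_right quad_form_def matrix_vector_mult_scaleR inner_commute)
    also have "\<bar>\<dots>\<bar> \<le> norm (gradient f (x + z *\<^sub>R y) - gradient f x - hessian f x *v (z *\<^sub>R y)) * norm y"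
      by (rule Cauchy_Schwarz_ineq2)
    also have "\<dots> \<le> (e * norm (z *\<^sub>R y)) * norm y"
      using d(2)[of "x + z *\<^sub>R y"] zy that by (intro mult_right_mono) auto
    also have "\<dots> \<le> (e * norm y) * norm y"
      using zy \<open>e > 0\<close> by (intro mult_right_mono mult_left_mono) auto
    finally have "\<bar>\<theta> 1 - \<theta> 0\<bar> \<le> e * (norm y)\<^sup>2" by (simp add: power2_eq_square mult.assoc)
    moreover have "\<theta> 1 - \<theta> 0 = f (x + y) - f x - gradient f x \<bullet> y - ?q / 2" by (simp add: \<theta>_def)
    ultimately show ?thesis by simp
  qed
  then show ?thesis using that d(1) by blast
qed

section \<open>Expansions along parabolic arcs\<close>

lemma eventually_arc_near:
  fixes v :: "'a::real_normed_vector"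
  assumes "d > 0"
  shows "\<forall>\<^sub>F t in at_right 0. \<forall>w\<in>cball 0 r. norm (t *\<^sub>R v + (t\<^sup>2 / 2) *\<^sub>R w) < d"
proof -
  have "((\<lambda>t. t * norm v + t\<^sup>2 / 2 * r) \<longlongrightarrow> 0 * norm v + 0\<^sup>2 / 2 * r) (at_right 0)"
    by (intro tendsto_intros) simp
  then have "\<forall>\<^sub>F t in at_right 0. t * norm v + t\<^sup>2 / 2 * r < d"
    using \<open>d > 0\<close> by (intro order_tendstoD) auto
  then show ?thesis using eventually_at_right_less[of 0]
  proof eventually_elim
    case (elim t)
    show ?case
    proof
      fix w :: 'a assume w: "w \<in> cball 0 r"
      have "norm (t *\<^sub>R v + (t\<^sup>2 / 2) *\<^sub>R w) \<le> norm (t *\<^sub>R v) + norm ((t\<^sup>2 / 2) *\<^sub>R w)"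
        by (rule norm_triangle_ineq)
      also have "\<dots> \<le> t * norm v + t\<^sup>2 / 2 * r"
        using w elim by (auto intro!: add_mono mult_left_mono)
      finally show "norm (t *\<^sub>R v + (t\<^sup>2 / 2) *\<^sub>R w) < d" using elim by simp
    qed
  qed
qed

text \<open>Uniformity over the accelerations \<open>w\<close> in a ball is essential: the
  acceleration is fixed only after \<open>t\<close>, by a fixed point argument.\<close>

lemma eventually_arc_expansion:
  fixes f :: "real^'n \<Rightarrow> real"
  assumes f: "\<And>x. f differentiable (at x)" "gradient f differentiable (at x)" and "e > 0"
  shows "\<forall>\<^sub>F t in at_right 0. \<forall>w\<in>cball 0 r.
    \<bar>f (x + (t *\<^sub>R v + (t\<^sup>2 / 2) *\<^sub>R w)) - f x - t * (gradient f x \<bullet> v)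
      - t\<^sup>2 / 2 * (gradient f x \<bullet> w + quad_form (hessian f x) v)\<bar> \<le> e * t\<^sup>2"
proof -
  let ?q = "quad_form (hessian f x)"
  \<comment> \<open>The displacement has norm at most \<open>t * N\<close> for small
    \<open>t\<close>. Taylor precision \<open>e / (2 * N\<^sup>2)\<close> then costs half of
    \<open>e * t\<^sup>2\<close>; replacing the quadratic term by its value at
    \<open>t *\<^sub>R v\<close> costs the other half.\<close>
  define N where "N = norm v + 1"
  have N: "N > 0" by (simp add: N_def add_nonneg_pos)
  obtain d where d: "d > 0" "\<And>y. norm y < d \<Longrightarrow>
      \<bar>f (x + y) - f x - gradient f x \<bullet> y - ?q y / 2\<bar> \<le> (e / (2 * N\<^sup>2)) * (norm y)\<^sup>2"
    using second_order_taylor[OF f, of "e / (2 * N\<^sup>2)"] \<open>e > 0\<close> N by auto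
  have "continuous_on UNIV ?q" by (intro continuous_intros)
  then have "isCont ?q v" by (simp add: continuous_on_eq_continuous_at)
  then obtain d2 where d2: "d2 > 0" "\<And>y. dist y v < d2 \<Longrightarrow> dist (?q y) (?q v) < e"
    using \<open>e > 0\<close> unfolding continuous_at_eps_delta by blast
  have "((\<lambda>t. t / 2 * r) \<longlongrightarrow> 0 / 2 * r) (at_right 0)" by (intro tendsto_intros) simp
  then have "\<forall>\<^sub>F t in at_right 0. t / 2 * r < min d2 1" using d2 by (intro order_tendstoD) auto
  then show ?thesis using eventually_arc_near[OF d(1), of r v] eventually_at_right_less[of 0]
  proof eventually_elim
    case (elim t)
    show ?case
    proof
      fix w :: "real^'n" assume w: "w \<in> cball 0 r"
      define y where "y = t *\<^sub>R v + (t\<^sup>2 / 2) *\<^sub>R w"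
      have y: "y = t *\<^sub>R (v + (t / 2) *\<^sub>R w)"
        by (simp add: y_def scaleR_add_right power2_eq_square)
      have "norm ((t / 2) *\<^sub>R w) \<le> t / 2 * r" using w elim by (auto intro!: mult_left_mono)
      then have tw: "norm ((t / 2) *\<^sub>R w) < d2" "norm ((t / 2) *\<^sub>R w) \<le> 1" using elim by linarith+
      have "norm (v + (t / 2) *\<^sub>R w) \<le> N"
        using norm_triangle_ineq[of v "(t / 2) *\<^sub>R w"] tw unfolding N_def by linarith
      then have "norm y \<le> t * N" unfolding y using elim by (auto intro!: mult_left_mono)
      then have "(norm y)\<^sup>2 \<le> (t * N)\<^sup>2" by (intro power_mono) auto
      then have "(e / (2 * N\<^sup>2)) * (norm y)\<^sup>2 \<le> (e / (2 * N\<^sup>2)) * (t * N)\<^sup>2"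
        using \<open>e > 0\<close> by (intro mult_left_mono) auto
      also have "\<dots> = e / 2 * t\<^sup>2" using N by (simp add: power_mult_distrib)
      finally have 1: "\<bar>f (x + y) - f x - gradient f x \<bullet> y - ?q y / 2\<bar> \<le> e / 2 * t\<^sup>2"
        using order_trans[OF d(2)[of y]] elim w unfolding y_def by blast
      have "?q y = t\<^sup>2 * ?q (v + (t / 2) *\<^sub>R w)" unfolding y by simp
      then have "\<bar>?q y - t\<^sup>2 * ?q v\<bar> = t\<^sup>2 * \<bar>?q (v + (t / 2) *\<^sub>R w) - ?q v\<bar>"
        by (simp add: abs_mult flip: right_diff_distrib)
      also have "\<dots> \<le> t\<^sup>2 * e"
        using d2(2)[of "v + (t / 2) *\<^sub>R w"] tw by (intro mult_left_mono) (auto simp: dist_norm)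
      finally have 2: "\<bar>?q y - t\<^sup>2 * ?q v\<bar> \<le> t\<^sup>2 * e" .
      have 3: "gradient f x \<bullet> y = t * (gradient f x \<bullet> v) + t\<^sup>2 / 2 * (gradient f x \<bullet> w)"
        by (simp add: y_def inner_add_right)
      have "f (x + y) - f x - t * (gradient f x \<bullet> v) - t\<^sup>2 / 2 * (gradient f x \<bullet> w + ?q v)
        = (f (x + y) - f x - gradient f x \<bullet> y - ?q y / 2) + (?q y - t\<^sup>2 * ?q v) / 2"
        unfolding 3 by (simp add: field_simps)
      then show "\<bar>f (x + (t *\<^sub>R v + (t\<^sup>2 / 2) *\<^sub>R w)) - f x - t * (gradient f x \<bullet> v)
          - t\<^sup>2 / 2 * (gradient f x \<bullet> w + ?q v)\<bar> \<le> e * t\<^sup>2"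
        using 1 2 unfolding y_def[symmetric] by (simp add: abs_if field_simps split: if_splits)
    qed
  qed
qed

section \<open>Linear alternatives\<close>

text \<open>\<open>M\<close> combines dual vectors of the family. It is the right inverse of the
  equality Jacobian used to correct arcs and to read off single equality multipliers.\<close>

lemma independent_family_right_inverse:
  fixes a :: "'q::finite \<Rightarrow> real^'n"
  assumes inj: "inj_on a Q" and ind: "independent (a ` Q)"
  obtains M :: "real^'q \<Rightarrow> real^'n" where "linear M" "\<And>j z. j \<in> Q \<Longrightarrow> a j \<bullet> M z = z $ j"
proof -
  have "\<exists>c. \<forall>j\<in>Q. a j \<bullet> c = (if j = k then 1 else 0)" if "k \<in> Q" for k
  proof -
    obtain \<phi> :: "real^'n \<Rightarrow> real" where \<phi>: "linear \<phi>" "\<forall>x\<in>a ` Q. \<phi> x = (if x = a k then 1 else 0)"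
      using linear_independent_extend[OF ind, of "\<lambda>x. if x = a k then 1 else 0"] by blast
    have "a j \<bullet> adjoint \<phi> 1 = (if j = k then 1 else 0)" if "j \<in> Q" for j
      using \<phi> that \<open>k \<in> Q\<close> inj by (auto simp: adjoint_works inj_on_eq_iff)
    then show ?thesis by blast
  qed
  then obtain c where c: "\<And>k j. k \<in> Q \<Longrightarrow> j \<in> Q \<Longrightarrow> a j \<bullet> c k = (if j = k then 1 else 0)"
    by metis
  show ?thesis
  proof
    show "linear (\<lambda>z. \<Sum>k\<in>Q. z $ k *\<^sub>R c k)"
      by (intro linear_compose_sum ballI linearI) (auto simp: algebra_simps)
    show "a j \<bullet> (\<Sum>k\<in>Q. z $ k *\<^sub>R c k) = z $ j" if "j \<in> Q" for j z
    proof -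
      have "a j \<bullet> (\<Sum>k\<in>Q. z $ k *\<^sub>R c k) = (\<Sum>k\<in>Q. if j = k then z $ k else 0)"
        unfolding inner_sum_right by (intro sum.cong) (auto simp: c that)
      then show ?thesis using that by simp
    qed
  qed
qed

lemma nonneg_if_affine_nonneg:
  fixes c k :: real
  assumes "\<And>t. t > 0 \<Longrightarrow> 0 \<le> c + t * k"
  shows "0 \<le> k"
proof (rule ccontr)
  assume k: "\<not> 0 \<le> k"
  have "(\<bar>c\<bar> + 1) / (- k) > 0" using k by (intro divide_pos_pos) auto
  then have "0 \<le> c + (\<bar>c\<bar> + 1) / (- k) * k" by (rule assms)
  then show False using k by (simp add: field_simps abs_if split: if_splits)
qed

text \<open>The strict upper bounds of attainable values form a convex set \<open>D\<close>, and
  unsolvability means that \<open>D\<close> misses 0. The coefficients of a separating functional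
  are the multipliers.\<close>

lemma motzkin_alternative:
  fixes a0 :: "'a::euclidean_space" and a :: "'p::finite \<Rightarrow> 'a" and b :: "'q::finite \<Rightarrow> 'a"
    and \<alpha>0 :: real and \<alpha> :: "'p \<Rightarrow> real" and \<beta> :: "'q \<Rightarrow> real"
  assumes no: "\<not> (\<exists>w. a0 \<bullet> w + \<alpha>0 < 0 \<and> (\<forall>i\<in>I. a i \<bullet> w + \<alpha> i < 0) \<and> (\<forall>j\<in>Q. b j \<bullet> w + \<beta> j = 0))"
  obtains l0 and l :: "real^'p" and m :: "real^'q"
  where "0 \<le> l0" "\<And>i. 0 \<le> l$i" "\<And>i. i \<notin> I \<Longrightarrow> l$i = 0" "\<And>j. j \<notin> Q \<Longrightarrow> m$j = 0"
    "(l0, l, m) \<noteq> 0"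
    "l0 *\<^sub>R a0 + (\<Sum>i\<in>UNIV. l$i *\<^sub>R a i) + (\<Sum>j\<in>UNIV. m$j *\<^sub>R b j) = 0"
    "0 \<le> l0 * \<alpha>0 + (\<Sum>i\<in>UNIV. l$i * \<alpha> i) + (\<Sum>j\<in>UNIV. m$j * \<beta> j)"
proof -
  define D where "D = {(y0 :: real, y :: real^'p, z :: real^'q).
    \<exists>w. a0 \<bullet> w + \<alpha>0 < y0 \<and> (\<forall>i\<in>I. a i \<bullet> w + \<alpha> i < y$i) \<and> (\<forall>j\<in>Q. b j \<bullet> w + \<beta> j = z$j)}"
  have comb: "c \<bullet> (u *\<^sub>R w + v *\<^sub>R w') + \<gamma> = u * (c \<bullet> w + \<gamma>) + v * (c \<bullet> w' + \<gamma>)"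
    if "u + v = 1" for c w w' :: 'a and u v \<gamma> :: real
  proof -
    have "\<gamma> = u * \<gamma> + v * \<gamma>" using that by (simp flip: distrib_right)
    then show ?thesis by (simp add: inner_add_right distrib_left)
  qed
  have comb_less: "u * s + v * t < u * s' + v * t'"
    if "s < s'" "t < t'" "0 \<le> u" "0 \<le> v" "u + v = 1" for u v s t s' t' :: real
    using that by (cases "u = 0") (auto intro!: add_less_le_mono mult_left_mono)
  have "convex D"
  proof (rule convexI)
    fix x y :: "real \<times> (real^'p) \<times> (real^'q)" and u v :: real
    assume xy: "x \<in> D" "y \<in> D" and uv: "0 \<le> u" "0 \<le> v" "u + v = 1"
    obtain x0 x1 x2 y0 y1 y2 where eq: "x = (x0, x1, x2)" "y = (y0, y1, y2)" by (metis prod_cases3)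
    obtain w w' where
      "a0 \<bullet> w + \<alpha>0 < x0" "\<forall>i\<in>I. a i \<bullet> w + \<alpha> i < x1$i" "\<forall>j\<in>Q. b j \<bullet> w + \<beta> j = x2$j"
      "a0 \<bullet> w' + \<alpha>0 < y0" "\<forall>i\<in>I. a i \<bullet> w' + \<alpha> i < y1$i" "\<forall>j\<in>Q. b j \<bullet> w' + \<beta> j = y2$j"
      using xy by (auto simp: D_def eq)
    then have "a0 \<bullet> (u *\<^sub>R w + v *\<^sub>R w') + \<alpha>0 < u * x0 + v * y0"
      "\<forall>i\<in>I. a i \<bullet> (u *\<^sub>R w + v *\<^sub>R w') + \<alpha> i < u * x1$i + v * y1$i"
      "\<forall>j\<in>Q. b j \<bullet> (u *\<^sub>R w + v *\<^sub>R w') + \<beta> j = u * x2$j + v * y2$j"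
      unfolding comb[OF uv(3)] using uv by (auto intro!: comb_less)
    then show "u *\<^sub>R x + v *\<^sub>R y \<in> D" by (auto simp: D_def eq)
  qed
  moreover have "0 \<notin> D" using no by (auto simp: D_def zero_prod_def)
  ultimately obtain n where n: "n \<noteq> 0" "\<forall>x\<in>D. 0 \<le> n \<bullet> x"
    using separating_hyperplane_set_0 by blast
  obtain l0 l m where nlm: "n = (l0, l, m)" by (metis prod_cases3)
  \<comment> \<open>\<open>D\<close> is stable under adding these directions, so the functional is
    nonnegative on them. Coordinates outside \<open>I\<close> or \<open>Q\<close> are unrestricted
    where the corresponding multiplier has to vanish.\<close>
  have dir: "0 \<le> l0 * s + l \<bullet> y + m \<bullet> z"
    if s: "0 \<le> s" "\<And>i. i \<in> I \<Longrightarrow> 0 \<le> y$i" "\<And>j. j \<in> Q \<Longrightarrow> z$j = 0" for s y z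
  proof -
    define c where "c = n \<bullet> (\<alpha>0 + 1, (\<chi> i. \<alpha> i + 1), (\<chi> j. \<beta> j))"
    have "0 \<le> c + t * (l0 * s + l \<bullet> y + m \<bullet> z)" if "t > 0" for t
    proof -
      have "(\<alpha>0 + 1, (\<chi> i. \<alpha> i + 1), (\<chi> j. \<beta> j)) + t *\<^sub>R (s, y, z) \<in> D"
        unfolding D_def using s \<open>t > 0\<close> by (auto intro!: exI[of _ 0] add_pos_nonneg)
      then have "0 \<le> n \<bullet> ((\<alpha>0 + 1, (\<chi> i. \<alpha> i + 1), (\<chi> j. \<beta> j)) + t *\<^sub>R (s, y, z))"
        using n(2) by blast
      then have "0 \<le> c + t * (n \<bullet> (s, y, z))"
        unfolding c_def inner_add_right inner_scaleR_right .
      then show ?thesis by (simp add: nlm add.assoc)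
    qed
    then show ?thesis by (rule nonneg_if_affine_nonneg)
  qed
  have l0: "0 \<le> l0" using dir[of 1 0 0] by simp
  have l: "0 \<le> l$i" for i
  proof -
    have "0 \<le> (axis i 1 :: real^'p) $ k" for k by (simp add: axis_def)
    then show ?thesis using dir[of 0 "axis i 1" 0] by (simp add: inner_axis)
  qed
  have lI: "l$i = 0" if "i \<notin> I" for i
  proof -
    have "0 \<le> (axis i (- 1) :: real^'p) $ k" if "k \<in> I" for k
      using that \<open>i \<notin> I\<close> by (auto simp: axis_def)
    then have "0 \<le> - l$i" using dir[of 0 "axis i (- 1)" 0] by (simp add: inner_axis)
    then show ?thesis using l[of i] by simp
  qed
  have mQ: "m$j = 0" if "j \<notin> Q" for j
  proof -
    have "(axis j c :: real^'q) $ k = 0" if "k \<in> Q" for k c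
      using that \<open>j \<notin> Q\<close> by (auto simp: axis_def)
    then have "0 \<le> m$j * c" for c using dir[of 0 0 "axis j c"] by (simp add: inner_axis)
    from this[of 1] this[of "- 1"] show ?thesis by simp
  qed
  define A where "A = l0 *\<^sub>R a0 + (\<Sum>i\<in>UNIV. l$i *\<^sub>R a i) + (\<Sum>j\<in>UNIV. m$j *\<^sub>R b j)"
  define c where "c = l0 * \<alpha>0 + (\<Sum>i\<in>UNIV. l$i * \<alpha> i) + (\<Sum>j\<in>UNIV. m$j * \<beta> j)"
  define K where "K = l0 + (\<Sum>i\<in>UNIV. l$i)"
  \<comment> \<open>The slack \<open>1/t\<close> puts the values at \<open>w\<close> into the strict
    set \<open>D\<close>; its total contribution \<open>K / t\<close> disappears for large
    \<open>t\<close>.\<close>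
  have Aw: "0 \<le> A \<bullet> w + c" for w
  proof (rule nonneg_if_affine_nonneg[of K])
    fix t :: real assume "t > 0"
    have "(a0 \<bullet> w + \<alpha>0 + 1/t, (\<chi> i. a i \<bullet> w + \<alpha> i + 1/t), (\<chi> j. b j \<bullet> w + \<beta> j)) \<in> D"
      unfolding D_def using \<open>t > 0\<close> by (auto intro!: exI[of _ w])
    then have "0 \<le> n \<bullet> (a0 \<bullet> w + \<alpha>0 + 1/t, (\<chi> i. a i \<bullet> w + \<alpha> i + 1/t), (\<chi> j. b j \<bullet> w + \<beta> j))"
      using n(2) by blast
    also have "\<dots> = A \<bullet> w + c + K / t"
      by (simp add: nlm A_def c_def K_def inner_vec_def inner_add_left inner_sum_left distrib_left
          sum.distrib sum_divide_distrib add_divide_distrib)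
    finally show "0 \<le> K + t * (A \<bullet> w + c)" using \<open>t > 0\<close> by (simp add: field_simps)
  qed
  have "0 \<le> - (A \<bullet> A)"
  proof (rule nonneg_if_affine_nonneg[of c])
    show "0 \<le> c + t * - (A \<bullet> A)" for t using Aw[of "- t *\<^sub>R A"] by simp
  qed
  then have "A = 0" by (metis inner_ge_zero inner_eq_zero_iff neg_0_le_iff_le order_antisym)
  moreover have "0 \<le> c" using Aw[of 0] by simp
  ultimately show ?thesis using that l0 l lI mQ n(1) unfolding nlm A_def c_def by blast
qed

section \<open>Multipliers and second-order necessary conditions\<close>

lemma affine_combination:
  fixes c :: "'a::real_vector"
  assumes "a + b = 1"
  shows "a *\<^sub>R (c + y + z) + b *\<^sub>R (c + y' + z') = c + (a *\<^sub>R y + b *\<^sub>R y') + (a *\<^sub>R z + b *\<^sub>R z')"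
proof -
  have "a *\<^sub>R c + b *\<^sub>R c = c" using assms by (simp flip: scaleR_add_left)
  then show ?thesis by (simp add: scaleR_add_right algebra_simps)
qed

text \<open>Stated for an arbitrary vector space, so that it serves both the gradient and the
  Hessian of the Lagrangian as affine functions of the multipliers.\<close>

lemma lagrangian_term_combination:
  fixes c :: "'a::real_vector" and y :: "'p::finite \<Rightarrow> 'a" and z :: "'q::finite \<Rightarrow> 'a"
    and l l' :: "real^'p" and u u' :: "real^'q"
  assumes "a + b = 1"
  shows "c + (\<Sum>i\<in>P. (a *\<^sub>R l + b *\<^sub>R l') $ i *\<^sub>R y i) + (\<Sum>j\<in>Q. (a *\<^sub>R u + b *\<^sub>R u') $ j *\<^sub>R z j)
    = a *\<^sub>R (c + (\<Sum>i\<in>P. l $ i *\<^sub>R y i) + (\<Sum>j\<in>Q. u $ j *\<^sub>R z j))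
    + b *\<^sub>R (c + (\<Sum>i\<in>P. l' $ i *\<^sub>R y i) + (\<Sum>j\<in>Q. u' $ j *\<^sub>R z j))"
  unfolding affine_combination[OF assms]
  by (simp add: scaleR_add_left sum.distrib scaleR_sum_right)

text \<open>One radius serves two purposes: it bounds the corrections \<open>z\<close> and is the
  margin left in the strict inequality, since a correction costs only a multiple of
  \<open>\<rho>\<close>.\<close>

lemma eventually_strict_margin:
  fixes a w :: "'a::real_inner" and M :: "'b::real_normed_vector \<Rightarrow> 'a"
  assumes "a \<bullet> w + \<alpha> < 0" "\<And>z. norm (M z) \<le> B * norm z" "0 \<le> B"
  shows "\<forall>\<^sub>F \<rho> in at_right 0. \<forall>z\<in>cball 0 \<rho>. a \<bullet> (w + M z) + \<alpha> \<le> - \<rho>"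
proof -
  have "((\<lambda>\<rho>. norm a * (B * \<rho>) + \<rho> + (a \<bullet> w + \<alpha>)) \<longlongrightarrow> norm a * (B * 0) + 0 + (a \<bullet> w + \<alpha>)) (at_right 0)"
    by (intro tendsto_intros)
  then have "\<forall>\<^sub>F \<rho> in at_right 0. norm a * (B * \<rho>) + \<rho> + (a \<bullet> w + \<alpha>) < 0"
    using assms(1) by (intro order_tendstoD) auto
  then show ?thesis
  proof eventually_elim
    case (elim \<rho>)
    show ?case
    proof
      fix z :: 'b assume z: "z \<in> cball 0 \<rho>"
      have "a \<bullet> M z \<le> norm a * norm (M z)" by (rule norm_cauchy_schwarz)
      also have "\<dots> \<le> norm a * (B * \<rho>)"
        using z assms(3) by (intro mult_left_mono order_trans[OF assms(2)]) auto
      finally show "a \<bullet> (w + M z) + \<alpha> \<le> - \<rho>" using elim by (simp add: inner_add_right)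
    qed
  qed
qed

lemma twice_continuously_differentiableD:
  assumes "twice_continuously_differentiable f"
  shows "f differentiable (at x)" "gradient f differentiable (at x)"
  using assms by (auto simp: twice_continuously_differentiable_def)

locale smooth_program =
  fixes f :: "real^'n \<Rightarrow> real" and g :: "'p::finite \<Rightarrow> real^'n \<Rightarrow> real"
    and h :: "'q::finite \<Rightarrow> real^'n \<Rightarrow> real" and P :: "'p set" and Q :: "'q set"
  assumes f: "twice_continuously_differentiable f"
    and g: "\<And>i. i \<in> P \<Longrightarrow> twice_continuously_differentiable (g i)"
    and h: "\<And>j. j \<in> Q \<Longrightarrow> twice_continuously_differentiable (h j)"
begin

lemma gradient_lagrangian:
  "gradient (lagrangian f g h P Q l u) x = gradient f x
    + (\<Sum>i\<in>P. l$i *\<^sub>R gradient (g i) x) + (\<Sum>j\<in>Q. u$j *\<^sub>R gradient (h j) x)"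
proof (rule gradient_eqI)
  have "((\<lambda>x. f x + (\<Sum>i\<in>P. l$i * g i x) + (\<Sum>j\<in>Q. u$j * h j x)) has_derivative
      (\<lambda>d. gradient f x \<bullet> d + (\<Sum>i\<in>P. l$i * (gradient (g i) x \<bullet> d))
        + (\<Sum>j\<in>Q. u$j * (gradient (h j) x \<bullet> d)))) (at x)"
    by (intro has_derivative_add has_derivative_sum has_derivative_mult_right
        has_derivative_gradient twice_continuously_differentiableD f g h)
  then show "(lagrangian f g h P Q l u has_derivative
      (\<lambda>d. (gradient f x + (\<Sum>i\<in>P. l$i *\<^sub>R gradient (g i) x) + (\<Sum>j\<in>Q. u$j *\<^sub>R gradient (h j) x)) \<bullet> d)) (at x)"
    unfolding lagrangian_def[abs_def] by (simp add: inner_add_left inner_sum_left)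
qed

lemma hessian_lagrangian:
  "hessian (lagrangian f g h P Q l u) x = hessian f x
    + (\<Sum>i\<in>P. l$i *\<^sub>R hessian (g i) x) + (\<Sum>j\<in>Q. u$j *\<^sub>R hessian (h j) x)"
proof (rule hessian_eqI)
  have "((\<lambda>x. gradient f x
    + (\<Sum>i\<in>P. l$i *\<^sub>R gradient (g i) x) + (\<Sum>j\<in>Q. u$j *\<^sub>R gradient (h j) x)) has_derivative (\<lambda>d. hessian f x *v d
    + (\<Sum>i\<in>P. l$i *\<^sub>R (hessian (g i) x *v d)) + (\<Sum>j\<in>Q. u$j *\<^sub>R (hessian (h j) x *v d)))) (at x)"
    by (intro has_derivative_add has_derivative_sum has_derivative_scaleR_right
        has_derivative_hessian twice_continuously_differentiableD f g h)
  then show "(gradient (lagrangian f g h P Q l u) has_derivative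
      (\<lambda>d. (hessian f x + (\<Sum>i\<in>P. l$i *\<^sub>R hessian (g i) x)
        + (\<Sum>j\<in>Q. u$j *\<^sub>R hessian (h j) x)) *v d)) (at x)"
    by (simp add: gradient_lagrangian[abs_def] matrix_vector_mult_add_rdistrib sum_matrix_vector_mult
        scaleR_matrix_vector_assoc)
qed

lemma quad_form_hessian_lagrangian:
  "quad_form (hessian (lagrangian f g h P Q l u) x) v = quad_form (hessian f x) v
    + (\<Sum>i\<in>P. l$i * quad_form (hessian (g i) x) v) + (\<Sum>j\<in>Q. u$j * quad_form (hessian (h j) x) v)"
  by (simp add: hessian_lagrangian quad_form_add_matrix quad_form_sum_matrix quad_form_scale_matrix)

text \<open>Along the parabolic arc \<open>t v + t\<^sup>2/2 (w + M z)\<close>, the rescaled equality constraints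
  \<open>2 h\<^sub>j / t\<^sup>2\<close> are uniformly close to \<open>z\<^sub>j\<close>, so by Brouwer's theorem they vanish for some small \<open>z\<close>.\<close>

lemma no_second_order_descent:
  fixes M :: "real^'q \<Rightarrow> real^'n"
  assumes min: "local_minimizer f (feasible_set g h P Q) x"
    and M: "linear M" "\<And>j z. j \<in> Q \<Longrightarrow> gradient (h j) x \<bullet> M z = z $ j"
    and v: "v \<in> critical_cone f g h P Q x"
    and wf: "gradient f x \<bullet> w + quad_form (hessian f x) v < 0"
    and wg: "\<And>i. i \<in> active_set g P x \<Longrightarrow> gradient (g i) x \<bullet> w + quad_form (hessian (g i) x) v < 0"
    and wh: "\<And>j. j \<in> Q \<Longrightarrow> gradient (h j) x \<bullet> w + quad_form (hessian (h j) x) v = 0"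
  shows False
proof -
  let ?I = "active_set g P x"
  note tcd = twice_continuously_differentiableD
  have IP: "i \<in> P" "g i x = 0" if "i \<in> ?I" for i using that by (auto simp: active_set_def)
  have gle: "g i x \<le> 0" if "i \<in> P" for i
    using min that by (auto simp: local_minimizer_def feasible_set_def)
  have h0: "h j x = 0" if "j \<in> Q" for j
    using min that by (auto simp: local_minimizer_def feasible_set_def)
  obtain \<delta> where \<delta>: "\<delta> > 0" "\<And>y. y \<in> feasible_set g h P Q \<Longrightarrow> dist x y < \<delta> \<Longrightarrow> f x \<le> f y"
    using min by (auto simp: local_minimizer_def)
  obtain B where B: "B > 0" "\<And>z. norm (M z) \<le> B * norm z"
    using linear_bounded_pos[OF M(1)] by blast
  have "\<forall>\<^sub>F \<rho> in at_right 0.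
      (\<forall>z\<in>cball 0 \<rho>. gradient f x \<bullet> (w + M z) + quad_form (hessian f x) v \<le> - \<rho>) \<and>
      (\<forall>i\<in>?I. \<forall>z\<in>cball 0 \<rho>. gradient (g i) x \<bullet> (w + M z) + quad_form (hessian (g i) x) v \<le> - \<rho>) \<and>
      0 < \<rho>"
    using B
    by (intro eventually_conj eventually_ball_finite ballI eventually_strict_margin wf wg
        eventually_at_right_less) auto
  from eventually_happens'[OF trivial_limit_at_right_real this] obtain \<rho> where \<rho>0:
    "\<forall>z\<in>cball 0 \<rho>. gradient f x \<bullet> (w + M z) + quad_form (hessian f x) v \<le> - \<rho>"
    "\<forall>i\<in>?I. \<forall>z\<in>cball 0 \<rho>. gradient (g i) x \<bullet> (w + M z) + quad_form (hessian (g i) x) v \<le> - \<rho>"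
    "0 < \<rho>" by (elim exE conjE) (rule that)
  note \<rho> = \<rho>0(3) bspec[OF \<rho>0(1)] bspec[OF bspec[OF \<rho>0(2)]]
  define r where "r = norm w + B * \<rho>"
  have wr: "w + M z \<in> cball 0 r" if "z \<in> cball 0 \<rho>" for z
  proof -
    have "norm (w + M z) \<le> norm w + norm (M z)" by (rule norm_triangle_ineq)
    also have "\<dots> \<le> r"
      unfolding r_def using that B by (intro add_left_mono order_trans[OF B(2)]) auto
    finally show ?thesis by simp
  qed
  \<comment> \<open>The bound \<open>\<rho> / 4\<close> keeps the expansion error below the
    second-order decrease \<open>\<rho> / 2\<close>, and the factor \<open>CARD('q)\<close> lets
    coordinate errors \<open>2 * e\<close> add up to at most \<open>\<rho>\<close>.\<close>
  define e where "e = \<rho> / (4 * real CARD('q))"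
  have e: "0 < e" "e \<le> \<rho> / 4" "real CARD('q) * (2 * e) \<le> \<rho>"
  proof -
    have c: "real CARD('q) \<ge> 1" by (simp add: Suc_le_eq)
    then show "0 < e" "real CARD('q) * (2 * e) \<le> \<rho>" using \<rho>(1) by (auto simp: e_def)
    have "\<rho> / (4 * real CARD('q)) \<le> \<rho> / (4 * 1)" using c \<rho>(1) by (intro divide_left_mono) auto
    then show "e \<le> \<rho> / 4" by (simp add: e_def)
  qed
  let ?arc = "\<lambda>t w. x + (t *\<^sub>R v + (t\<^sup>2 / 2) *\<^sub>R w)"
  let ?exp = "\<lambda>\<phi> t. \<forall>w\<in>cball 0 r. \<bar>\<phi> (?arc t w) - \<phi> x - t * (gradient \<phi> x \<bullet> v)
      - t\<^sup>2 / 2 * (gradient \<phi> x \<bullet> w + quad_form (hessian \<phi> x) v)\<bar> \<le> e * t\<^sup>2"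
  have inactive: "\<forall>\<^sub>F t in at_right 0. \<forall>w\<in>cball 0 r. g i (?arc t w) < 0" if i: "i \<in> P - ?I" for i
  proof -
    have "g i x < 0" using gle[of i] i by (auto simp: active_set_def)
    moreover have "isCont (g i) x"
      using tcd(1)[OF g] i by (simp add: differentiable_imp_continuous_within)
    ultimately obtain d where d: "d > 0" "\<And>y. dist y x < d \<Longrightarrow> dist (g i y) (g i x) < - g i x"
      unfolding continuous_at_eps_delta by (metis neg_0_less_iff_less)
    have "\<forall>\<^sub>F t in at_right 0. \<forall>w\<in>cball 0 r. norm (t *\<^sub>R v + (t\<^sup>2 / 2) *\<^sub>R w) < d"
      by (rule eventually_arc_near[OF d(1)])
    then show ?thesis
    proof eventually_elim
      case (elim t)
      have "g i (x + y) < 0" if "norm y < d" for y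
        using d(2)[of "x + y"] that by (simp add: dist_norm abs_if split: if_splits)
      then show ?case using elim by blast
    qed
  qed
  have "\<forall>\<^sub>F t in at_right 0. 0 < t \<and> ?exp f t \<and> (\<forall>i\<in>?I. ?exp (g i) t) \<and> (\<forall>j\<in>Q. ?exp (h j) t)
      \<and> (\<forall>i\<in>P - ?I. \<forall>w\<in>cball 0 r. g i (?arc t w) < 0)
      \<and> (\<forall>w\<in>cball 0 r. norm (t *\<^sub>R v + (t\<^sup>2 / 2) *\<^sub>R w) < \<delta>)"
    by (intro eventually_conj eventually_ball_finite ballI eventually_arc_expansion tcd f g h IP(1)
        inactive eventually_arc_near \<delta>(1) e(1) eventually_at_right_less) auto
  from eventually_happens'[OF trivial_limit_at_right_real this]
  obtain t where t: "0 < t" and tf: "?exp f t" and tg: "\<forall>i\<in>?I. ?exp (g i) t"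
    and th: "\<forall>j\<in>Q. ?exp (h j) t"
    and tin: "\<forall>i\<in>P - ?I. \<forall>w\<in>cball 0 r. g i (?arc t w) < 0"
    and tnear: "\<forall>w\<in>cball 0 r. norm (t *\<^sub>R v + (t\<^sup>2 / 2) *\<^sub>R w) < \<delta>"
    by (elim exE conjE) (rule that)
  define X where "X z = ?arc t (w + M z)" for z
  have descent: "\<phi> (X z) < \<phi> x"
    if "?exp \<phi> t" "z \<in> cball 0 \<rho>" "gradient \<phi> x \<bullet> v \<le> 0"
      "gradient \<phi> x \<bullet> (w + M z) + quad_form (hessian \<phi> x) v \<le> - \<rho>" for \<phi> z
  proof -
    have "\<bar>\<phi> (X z) - \<phi> x - t * (gradient \<phi> x \<bullet> v)
      - t\<^sup>2 / 2 * (gradient \<phi> x \<bullet> (w + M z) + quad_form (hessian \<phi> x) v)\<bar> \<le> e * t\<^sup>2"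
      unfolding X_def using that(1) wr[OF that(2)] by (rule bspec)
    moreover have "t * (gradient \<phi> x \<bullet> v) \<le> 0" using that(3) t by (simp add: mult_le_0_iff)
    moreover have "t\<^sup>2 / 2 * (gradient \<phi> x \<bullet> (w + M z) + quad_form (hessian \<phi> x) v) \<le> t\<^sup>2 / 2 * - \<rho>"
      using that(4) by (rule mult_left_mono) simp
    moreover have "e * t\<^sup>2 \<le> \<rho> / 4 * t\<^sup>2" using e(2) by (rule mult_right_mono) simp
    moreover have "\<rho> / 4 * t\<^sup>2 < t\<^sup>2 / 2 * \<rho>" using \<rho>(1) t by simp
    ultimately show ?thesis by linarith
  qed
  \<comment> \<open>Zeros of \<open>F\<close> are the fixed points of \<open>z - F z\<close>.
    Coordinates outside \<open>Q\<close> are copied, so they contribute nothing to the size of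
    \<open>z - F z\<close>.\<close>
  define F where "F z = (\<chi> j. if j \<in> Q then 2 / t\<^sup>2 * h j (X z) else z $ j)" for z
  have contX: "continuous_on UNIV X"
    unfolding X_def using M(1)
    by (intro continuous_intros linear_continuous_on) (simp add: linear_conv_bounded_linear)
  have "continuous_on UNIV (\<lambda>z. if j \<in> Q then 2 / t\<^sup>2 * h j (X z) else z $ j)" for j
  proof (cases "j \<in> Q")
    case True
    have "continuous_on UNIV (h j)"
      using tcd(1)[OF h[OF True]]
      by (simp add: continuous_on_eq_continuous_at differentiable_imp_continuous_within)
    then have "continuous_on UNIV (\<lambda>z. h j (X z))" by (rule continuous_on_compose2[OF _ contX]) auto
    then show ?thesis using True t by (auto intro!: continuous_intros)
  qed (auto intro!: continuous_intros)
  then have contF: "continuous_on UNIV F" unfolding F_def by (intro continuous_on_vec_lambda)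
  have small: "norm (z - F z) \<le> \<rho>" if z: "z \<in> cball 0 \<rho>" for z
  proof -
    have "\<bar>(z - F z) $ j\<bar> \<le> 2 * e" for j
    proof (cases "j \<in> Q")
      case True
      have "\<bar>h j (X z) - h j x - t * (gradient (h j) x \<bullet> v)
          - t\<^sup>2 / 2 * (gradient (h j) x \<bullet> (w + M z) + quad_form (hessian (h j) x) v)\<bar> \<le> e * t\<^sup>2"
        unfolding X_def using bspec[OF th True] wr[OF z] by (rule bspec)
      moreover have "gradient (h j) x \<bullet> (w + M z) + quad_form (hessian (h j) x) v = z $ j"
        using wh[OF True] M(2)[OF True] by (simp add: inner_add_right)
      moreover have "gradient (h j) x \<bullet> v = 0" using v True by (simp add: critical_cone_def)
      ultimately have 1: "\<bar>h j (X z) - t\<^sup>2 / 2 * z $ j\<bar> \<le> e * t\<^sup>2" using h0[OF True] by simp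
      have "(z - F z) $ j = - (2 / t\<^sup>2 * (h j (X z) - t\<^sup>2 / 2 * z $ j))"
        using t True by (simp add: F_def right_diff_distrib)
      then have "\<bar>(z - F z) $ j\<bar> = 2 / t\<^sup>2 * \<bar>h j (X z) - t\<^sup>2 / 2 * z $ j\<bar>"
        by (simp only: abs_minus_cancel abs_mult abs_divide abs_numeral abs_power2)
      also have "\<dots> \<le> 2 / t\<^sup>2 * (e * t\<^sup>2)" using 1 by (rule mult_left_mono) simp
      also have "\<dots> = 2 * e" using t by simp
      finally show ?thesis .
    qed (use e in \<open>simp add: F_def\<close>)
    then have "(\<Sum>j\<in>UNIV. \<bar>(z - F z) $ j\<bar>) \<le> real CARD('q) * (2 * e)"
      by (intro sum_bounded_above[where K = "2 * e", simplified]) auto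
    then show ?thesis using norm_le_l1_cart[of "z - F z"] e(3) by linarith
  qed
  obtain z where z: "z \<in> cball 0 \<rho>" "z - F z = z"
  proof (rule brouwer[of "cball 0 \<rho>" "\<lambda>z. z - F z"])
    show "continuous_on (cball 0 \<rho>) (\<lambda>z. z - F z)"
      using contF by (intro continuous_intros) (rule continuous_on_subset, auto)
    show "(\<lambda>z. z - F z) \<in> cball 0 \<rho> \<rightarrow> cball 0 \<rho>" using small by auto
  qed (use \<rho>(1) in auto)
  have "h j (X z) = 0" if "j \<in> Q" for j
  proof -
    have "F z $ j = 0" using z(2) by simp
    then show ?thesis using that t by (simp add: F_def)
  qed
  moreover have "g i (X z) \<le> 0" if "i \<in> P" for i
  proof (cases "i \<in> ?I")
    case True
    have "g i (X z) < g i x"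
      using v True by (intro descent bspec[OF tg] z \<rho>(3)) (auto simp: critical_cone_def)
    then show ?thesis using IP(2)[OF True] by simp
  next
    case False
    then show ?thesis using bspec[OF bspec[OF tin] wr[OF z(1)], of i] that by (simp add: X_def less_imp_le)
  qed
  ultimately have "X z \<in> feasible_set g h P Q" by (simp add: feasible_set_def)
  moreover have "dist x (X z) < \<delta>" using bspec[OF tnear wr[OF z(1)]] by (subst dist_commute) (simp add: X_def dist_norm)
  ultimately have "f x \<le> f (X z)" by (rule \<delta>(2))
  moreover have "f (X z) < f x"
    using v by (intro descent tf z \<rho>(2)) (auto simp: critical_cone_def)
  ultimately show False by simp
qed

text \<open>Local minimality excludes an acceleration that decreases the objective and the active
  constraints to second order. The alternative yields multipliers with a weight \<open>l0\<close> on
  the objective; MFCQ makes it positive, and dividing by it normalizes.\<close>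

lemma second_order_necessary:
  assumes min: "local_minimizer f (feasible_set g h P Q) x"
    and mfcq: "MFCQ g h P Q x"
    and v: "v \<in> critical_cone f g h P Q x"
  obtains l u where "(l, u) \<in> multiplier_set f g h P Q x"
    "0 \<le> quad_form (hessian (lagrangian f g h P Q l u) x) v"
proof -
  let ?I = "active_set g P x"
  let ?G = "\<lambda>i. gradient (g i) x" and ?H = "\<lambda>j. gradient (h j) x"
  obtain M :: "real^'q \<Rightarrow> real^'n" where M: "linear M" "\<And>j z. j \<in> Q \<Longrightarrow> ?H j \<bullet> M z = z $ j"
    using independent_family_right_inverse[of ?H Q] mfcq unfolding MFCQ_def by blast
  obtain d where d: "\<And>i. i \<in> ?I \<Longrightarrow> ?G i \<bullet> d < 0" "\<And>j. j \<in> Q \<Longrightarrow> ?H j \<bullet> d = 0"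
    using mfcq unfolding MFCQ_def by blast
  have "\<not> (\<exists>w. gradient f x \<bullet> w + quad_form (hessian f x) v < 0 \<and>
      (\<forall>i\<in>?I. ?G i \<bullet> w + quad_form (hessian (g i) x) v < 0) \<and>
      (\<forall>j\<in>Q. ?H j \<bullet> w + quad_form (hessian (h j) x) v = 0))"
    using no_second_order_descent[OF min M v] by blast
  then obtain l0 and l :: "real^'p" and m :: "real^'q" where lm: "0 \<le> l0" "\<And>i. 0 \<le> l$i"
    "\<And>i. i \<notin> ?I \<Longrightarrow> l$i = 0" "\<And>j. j \<notin> Q \<Longrightarrow> m$j = 0" "(l0, l, m) \<noteq> 0"
    and grad: "l0 *\<^sub>R gradient f x + (\<Sum>i\<in>UNIV. l$i *\<^sub>R ?G i) + (\<Sum>j\<in>UNIV. m$j *\<^sub>R ?H j) = 0"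
    and quad: "0 \<le> l0 * quad_form (hessian f x) v + (\<Sum>i\<in>UNIV. l$i * quad_form (hessian (g i) x) v)
      + (\<Sum>j\<in>UNIV. m$j * quad_form (hessian (h j) x) v)"
    by (rule motzkin_alternative) (rule that)
  \<comment> \<open>Otherwise pairing stationarity with the MFCQ direction \<open>d\<close> leaves a
    zero sum of nonpositive terms, so \<open>l\<close> vanishes; testing with \<open>M\<close> then
    kills \<open>m\<close>, against nontriviality.\<close>
  have "l0 \<noteq> 0"
  proof
    assume l0: "l0 = 0"
    have "(\<Sum>i\<in>UNIV. l$i * (?G i \<bullet> d)) + (\<Sum>j\<in>UNIV. m$j * (?H j \<bullet> d)) = 0"
      using arg_cong[OF grad, of "\<lambda>y. y \<bullet> d"] l0 by (simp add: inner_add_left inner_sum_left)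
    moreover have "(\<Sum>j\<in>UNIV. m$j * (?H j \<bullet> d)) = 0"
      using d(2) lm(4) by (intro sum.neutral) (metis mult_eq_0_iff)
    ultimately have "(\<Sum>i\<in>UNIV. l$i * (?G i \<bullet> d)) = 0" by simp
    moreover have le: "l$i * (?G i \<bullet> d) \<le> 0" for i
      using d(1)[of i] lm(2,3)[of i] by (cases "i \<in> ?I") (auto simp: mult_le_0_iff)
    ultimately have "l$i * (?G i \<bullet> d) = 0" for i
      using sum_nonneg_eq_0_iff[of UNIV "\<lambda>i. - (l$i * (?G i \<bullet> d))"]
      by (simp add: sum_negf)
    then have l: "l$i = 0" for i using d(1)[of i] lm(3)[of i] by (cases "i \<in> ?I") force+
    have "m$k = 0" for k
    proof -
      have "(\<Sum>j\<in>UNIV. m$j *\<^sub>R ?H j) = 0" using grad l0 l by simp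
      then have "(\<Sum>j\<in>UNIV. m$j *\<^sub>R ?H j) \<bullet> M (axis k 1) = 0" by simp
      moreover have "(\<Sum>j\<in>UNIV. m$j *\<^sub>R ?H j) \<bullet> M (axis k 1) = (\<Sum>j\<in>UNIV. if j = k then m$j else 0)"
        unfolding inner_sum_left
      proof (intro sum.cong refl)
        show "(m$j *\<^sub>R ?H j) \<bullet> M (axis k 1) = (if j = k then m$j else 0)" for j
          using M(2)[of j "axis k 1"] lm(4)[of j] by (cases "j \<in> Q") (auto simp: axis_def)
      qed
      ultimately show ?thesis by simp
    qed
    then show False using lm(5) l0 l by (simp add: zero_prod_def vec_eq_iff)
  qed
  then have l0: "l0 > 0" using lm(1) by simp
  define L where "L = (1 / l0) *\<^sub>R l"
  define U where "U = (1 / l0) *\<^sub>R m"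
  have sumP: "(\<Sum>i\<in>P. L$i *\<^sub>R c i) = (1 / l0) *\<^sub>R (\<Sum>i\<in>UNIV. l$i *\<^sub>R c i)" for c :: "'p \<Rightarrow> 'c::real_vector"
  proof -
    have "(\<Sum>i\<in>P. l$i *\<^sub>R c i) = (\<Sum>i\<in>UNIV. l$i *\<^sub>R c i)"
      using lm(3) by (intro sum.mono_neutral_left) (auto simp: active_set_def)
    moreover have "(\<Sum>i\<in>P. L$i *\<^sub>R c i) = (1 / l0) *\<^sub>R (\<Sum>i\<in>P. l$i *\<^sub>R c i)"
      by (simp add: L_def scaleR_sum_right)
    ultimately show ?thesis by simp
  qed
  have sumQ: "(\<Sum>j\<in>Q. U$j *\<^sub>R c j) = (1 / l0) *\<^sub>R (\<Sum>j\<in>UNIV. m$j *\<^sub>R c j)" for c :: "'q \<Rightarrow> 'c::real_vector"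
  proof -
    have "(\<Sum>j\<in>Q. m$j *\<^sub>R c j) = (\<Sum>j\<in>UNIV. m$j *\<^sub>R c j)"
      using lm(4) by (intro sum.mono_neutral_left) auto
    moreover have "(\<Sum>j\<in>Q. U$j *\<^sub>R c j) = (1 / l0) *\<^sub>R (\<Sum>j\<in>Q. m$j *\<^sub>R c j)"
      by (simp add: U_def scaleR_sum_right)
    ultimately show ?thesis by simp
  qed
  have "gradient (lagrangian f g h P Q L U) x
      = (1 / l0) *\<^sub>R (l0 *\<^sub>R gradient f x + (\<Sum>i\<in>UNIV. l$i *\<^sub>R ?G i) + (\<Sum>j\<in>UNIV. m$j *\<^sub>R ?H j))"
    using l0 by (simp add: gradient_lagrangian sumP sumQ scaleR_add_right)
  then have "gradient (lagrangian f g h P Q L U) x = 0" using grad by simp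
  then have "(L, U) \<in> multiplier_set f g h P Q x"
    using lm l0 by (auto simp: multiplier_set_def L_def U_def active_set_def)
  moreover have "quad_form (hessian (lagrangian f g h P Q L U) x) v
      = (1 / l0) * (l0 * quad_form (hessian f x) v + (\<Sum>i\<in>UNIV. l$i * quad_form (hessian (g i) x) v)
      + (\<Sum>j\<in>UNIV. m$j * quad_form (hessian (h j) x) v))"
    using l0 sumP[of "\<lambda>i. quad_form (hessian (g i) x) v"] sumQ[of "\<lambda>j. quad_form (hessian (h j) x) v"]
    by (simp add: quad_form_hessian_lagrangian add_divide_distrib)
  then have "0 \<le> quad_form (hessian (lagrangian f g h P Q L U) x) v" using quad l0 by simp
  ultimately show ?thesis by (rule that)
qed

section \<open>Convexity and compactness of the multiplier set\<close>

text \<open>Projections and plain implications replace the pair pattern and bounded quantifiers, so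
  that convexity and closedness can be checked condition by condition.\<close>

lemma multiplier_set_iff:
  "z \<in> multiplier_set f g h P Q x \<longleftrightarrow>
    (\<forall>i. i \<notin> P \<longrightarrow> fst z $ i = 0) \<and> (\<forall>j. j \<notin> Q \<longrightarrow> snd z $ j = 0) \<and>
    gradient f x + (\<Sum>i\<in>P. fst z $ i *\<^sub>R gradient (g i) x)
      + (\<Sum>j\<in>Q. snd z $ j *\<^sub>R gradient (h j) x) = 0 \<and>
    (\<forall>i. i \<in> P \<longrightarrow> 0 \<le> fst z $ i \<and> fst z $ i * g i x = 0)"
  by (cases z) (auto simp: multiplier_set_def gradient_lagrangian)

lemma convex_multiplier_set:
  "convex (multiplier_set f g h P Q x)"
proof (rule convexI)
  fix z z' and a b :: real
  assume z: "z \<in> multiplier_set f g h P Q x" "z' \<in> multiplier_set f g h P Q x"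
    and ab: "0 \<le> a" "0 \<le> b" "a + b = 1"
  show "a *\<^sub>R z + b *\<^sub>R z' \<in> multiplier_set f g h P Q x"
    using z ab
    unfolding multiplier_set_iff fst_add fst_scaleR snd_add snd_scaleR
      lagrangian_term_combination[OF ab(3)]
    by auto (metis add.right_neutral mult_zero_right)
qed

lemma closed_multiplier_set:
  "closed (multiplier_set f g h P Q x)"
proof -
  have "closed {z \<in> UNIV. z \<in> multiplier_set f g h P Q x}"
    unfolding multiplier_set_iff
    by (intro closed_Collect_conj closed_Collect_all closed_Collect_imp open_Collect_const
        closed_Collect_eq closed_Collect_le continuous_intros) simp_all
  then show ?thesis by simp
qed

text \<open>Pairing stationarity with the MFCQ direction \<open>d\<close> writes the number for the
  objective as a sum of nonnegative terms, which bounds each inequality multiplier by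
  \<open>bl\<close>. Testing with \<open>M (axis j 1)\<close> isolates an equality multiplier and
  bounds it by \<open>bu\<close>.\<close>

lemma bounded_multiplier_set:
  assumes mfcq: "MFCQ g h P Q x"
  shows "bounded (multiplier_set f g h P Q x)"
proof -
  let ?I = "active_set g P x"
  let ?G = "\<lambda>i. gradient (g i) x" and ?H = "\<lambda>j. gradient (h j) x"
  obtain M :: "real^'q \<Rightarrow> real^'n" where M: "linear M" "\<And>j z. j \<in> Q \<Longrightarrow> ?H j \<bullet> M z = z $ j"
    using independent_family_right_inverse[of ?H Q] mfcq unfolding MFCQ_def by blast
  obtain d where d: "\<And>i. i \<in> ?I \<Longrightarrow> ?G i \<bullet> d < 0" "\<And>j. j \<in> Q \<Longrightarrow> ?H j \<bullet> d = 0"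
    using mfcq unfolding MFCQ_def by blast
  define bl where "bl i = (if i \<in> ?I then (gradient f x \<bullet> d) / - (?G i \<bullet> d) else 0)" for i
  define bp where "bp = norm (gradient f x) + (\<Sum>i\<in>P. bl i * norm (?G i))"
  define bu where "bu j = bp * norm (M (axis j 1))" for j :: 'q
  have bound: "norm z \<le> sum bl UNIV + sum bu UNIV" if z: "z \<in> multiplier_set f g h P Q x" for z
  proof -
    obtain l u where lu: "z = (l, u)" by (cases z)
    have off: "\<And>i. i \<notin> P \<Longrightarrow> l $ i = 0" "\<And>j. j \<notin> Q \<Longrightarrow> u $ j = 0"
      and grad: "gradient f x + (\<Sum>i\<in>P. l $ i *\<^sub>R ?G i) + (\<Sum>j\<in>Q. u $ j *\<^sub>R ?H j) = 0"
      and l: "\<And>i. i \<in> P \<Longrightarrow> 0 \<le> l $ i" "\<And>i. i \<in> P \<Longrightarrow> l $ i * g i x = 0"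
      using z unfolding lu multiplier_set_iff by simp_all
    have lI: "l $ i = 0" if "i \<notin> ?I" for i
      using that off(1)[of i] l(2)[of i] by (auto simp: active_set_def)
    have l0: "0 \<le> l $ i" for i using off(1)[of i] l(1)[of i] by (cases "i \<in> P") auto
    have "gradient f x \<bullet> d + (\<Sum>i\<in>P. l $ i * (?G i \<bullet> d)) + (\<Sum>j\<in>Q. u $ j * (?H j \<bullet> d)) = 0"
      using arg_cong[OF grad, of "\<lambda>y. y \<bullet> d"] by (simp add: inner_add_left inner_sum_left)
    moreover have "(\<Sum>j\<in>Q. u $ j * (?H j \<bullet> d)) = 0" using d(2) by simp
    ultimately have fd: "gradient f x \<bullet> d = (\<Sum>i\<in>P. l $ i * - (?G i \<bullet> d))" by (simp add: sum_negf)
    have bl: "l $ i \<le> bl i" for i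
    proof (cases "i \<in> ?I")
      case True
      then have "i \<in> P" by (simp add: active_set_def)
      moreover have "0 \<le> l $ k * - (?G k \<bullet> d)" for k
        using lI[of k] l0[of k] d(1)[of k] by (cases "k \<in> ?I") (auto simp: mult_le_0_iff)
      ultimately have "l $ i * - (?G i \<bullet> d) \<le> gradient f x \<bullet> d"
        unfolding fd by (intro member_le_sum) auto
      then show ?thesis using d(1)[OF True] True by (simp add: bl_def pos_le_divide_eq del: divide_minus_right)
    qed (simp add: bl_def lI)
    have bu: "\<bar>u $ j\<bar> \<le> bu j" for j
    proof (cases "j \<in> Q")
      case True
      let ?p = "gradient f x + (\<Sum>i\<in>P. l $ i *\<^sub>R ?G i)"
      have "norm ?p \<le> norm (gradient f x) + norm (\<Sum>i\<in>P. l $ i *\<^sub>R ?G i)" by (rule norm_triangle_ineq)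
      also have "norm (\<Sum>i\<in>P. l $ i *\<^sub>R ?G i) \<le> (\<Sum>i\<in>P. bl i * norm (?G i))"
        using bl l0 by (intro sum_norm_le) (auto intro!: mult_right_mono)
      finally have bp: "norm ?p \<le> bp" by (simp add: bp_def)
      have "(\<Sum>k\<in>Q. u $ k *\<^sub>R ?H k) \<bullet> M (axis j 1) = (\<Sum>k\<in>Q. if k = j then u $ k else 0)"
        unfolding inner_sum_left using M(2) by (intro sum.cong refl) (auto simp: axis_def)
      then have "u $ j = (\<Sum>k\<in>Q. u $ k *\<^sub>R ?H k) \<bullet> M (axis j 1)" using True by simp
      also have "(\<Sum>k\<in>Q. u $ k *\<^sub>R ?H k) = - ?p" using grad by (simp only: add_eq_0_iff)
      also have "\<bar>- ?p \<bullet> M (axis j 1)\<bar> \<le> norm (- ?p) * norm (M (axis j 1))"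
        by (rule Cauchy_Schwarz_ineq2)
      also have "\<dots> \<le> bu j" unfolding bu_def using bp by (intro mult_right_mono) (simp_all only: norm_minus_cancel norm_ge_zero)
      finally show ?thesis .
    next
      case False
      have "0 \<le> bl i" for i using l0[of i] bl[of i] by linarith
      then have "0 \<le> bp" by (simp add: bp_def sum_nonneg)
      then show ?thesis using off(2)[OF False] by (simp add: bu_def)
    qed
    have "norm z \<le> norm l + norm u" unfolding lu by (rule norm_Pair_le)
    also have "\<dots> \<le> (\<Sum>i\<in>UNIV. \<bar>l $ i\<bar>) + (\<Sum>j\<in>UNIV. \<bar>u $ j\<bar>)"
      by (intro add_mono norm_le_l1_cart)
    also have "\<dots> \<le> sum bl UNIV + sum bu UNIV"
      using l0 bl bu by (intro add_mono sum_mono) auto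
    finally show ?thesis .
  qed
  then show ?thesis unfolding bounded_iff by blast
qed

end

section \<open>One multiplier for a whole regular cone\<close>

theorem theorem7:
  fixes f :: "real^'n \<Rightarrow> real"
    and g :: "'p::finite \<Rightarrow> real^'n \<Rightarrow> real"
    and h :: "'q::finite \<Rightarrow> real^'n \<Rightarrow> real"
    and P :: "'p set" and Q :: "'q set"
    and xs :: "real^'n"
    and m :: nat and lam :: "nat \<Rightarrow> real^'p" and mu :: "nat \<Rightarrow> real^'q"
    and A1 A2 A3 :: "real^'n^'n"
  assumes "twice_continuously_differentiable f"
    and "\<And>i. i \<in> P \<Longrightarrow> twice_continuously_differentiable (g i)"
    and "\<And>j. j \<in> Q \<Longrightarrow> twice_continuously_differentiable (h j)"
    and "local_minimizer f (feasible_set g h P Q) xs"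
    and "MFCQ g h P Q xs"
    and "(\<lambda>i. (lam i, mu i)) ` {1..m} = {z. z extreme_point_of multiplier_set f g h P Q xs}"
    and "symmetric_matrix A1" and "symmetric_matrix A2" and "symmetric_matrix A3"
    and "\<And>i. i \<in> {1..m} \<Longrightarrow>
           \<exists>r1 r2 r3. hessian (lagrangian f g h P Q (lam i) (mu i)) xs
             = r1 *\<^sub>R A1 + r2 *\<^sub>R A2 + r3 *\<^sub>R A3"
    and "\<exists>s1 s2 s3. positive_definite (s1 *\<^sub>R A1 + s2 *\<^sub>R A2 + s3 *\<^sub>R A3)"
  shows "\<forall>K. regular_cone K \<and> K \<subseteq> critical_cone f g h P Q xs \<and> dim K \<ge> 3 \<longrightarrow>
           (\<exists>(l, u) \<in> multiplier_set f g h P Q xs.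
              \<forall>v\<in>K. v \<bullet> (hessian (lagrangian f g h P Q l u) xs *v v) \<ge> 0)"
proof (intro allI impI, elim conjE)
  fix K assume K: "regular_cone K" "K \<subseteq> critical_cone f g h P Q xs" "3 \<le> dim K"
  interpret smooth_program f g h P Q using assms(1-3) by unfold_locales
  let ?\<Lambda> = "multiplier_set f g h P Q xs"
  let ?Q = "quad_map A1 A2 A3"
  define H where "H z = hessian (lagrangian f g h P Q (fst z) (snd z)) xs" for z
  define pencil where "pencil r = r$1 *\<^sub>R A1 + r$2 *\<^sub>R A2 + r$3 *\<^sub>R A3" for r :: "real^3"
  have H_affine: "H (a *\<^sub>R z + b *\<^sub>R z') = a *\<^sub>R H z + b *\<^sub>R H z'" if "a + b = 1" for a b z z'
    unfolding H_def hessian_lagrangian fst_add fst_scaleR snd_add snd_scaleR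
    by (rule lagrangian_term_combination[OF that])
  have pencil_affine: "pencil (a *\<^sub>R r + b *\<^sub>R r') = a *\<^sub>R pencil r + b *\<^sub>R pencil r'" for a b r r'
    by (simp add: pencil_def algebra_simps)
  define S where "S = K \<union> uminus ` K"
  have S: "subspace S" "3 \<le> dim S"
    using K dim_subset[of K S] by (auto simp: regular_cone_def S_def)
  have nonneg: "\<exists>z\<in>?\<Lambda>. 0 \<le> quad_form (H z) v" if "v \<in> S" for v
  proof -
    have "v \<in> K \<or> - v \<in> K" using that by (auto simp: S_def)
    then obtain w where "w \<in> K" "v = w \<or> v = - w" by (metis minus_minus)
    moreover from this obtain l u where "(l, u) \<in> ?\<Lambda>"
      "0 \<le> quad_form (hessian (lagrangian f g h P Q l u) xs) w"
      using second_order_necessary[OF assms(4,5)] K(2) by blast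
    ultimately show ?thesis by (intro bexI[of _ "(l, u)"]) (auto simp: H_def)
  qed
  define V where "V = (\<lambda>i. (lam i, mu i)) ` {1..m}"
  have convex: "convex ?\<Lambda>" by (rule convex_multiplier_set)
  have \<Lambda>: "?\<Lambda> = convex hull V"
    unfolding V_def assms(6)
    by (rule Krein_Milman_Minkowski)
      (simp_all add: convex compact_eq_bounded_closed closed_multiplier_set
        bounded_multiplier_set[OF assms(5)])
  have "\<exists>r. H z = pencil r" if "z \<in> V" for z
  proof -
    obtain i where i: "i \<in> {1..m}" "z = (lam i, mu i)" using \<open>z \<in> V\<close> by (auto simp: V_def)
    obtain r1 r2 r3 where "H z = r1 *\<^sub>R A1 + r2 *\<^sub>R A2 + r3 *\<^sub>R A3"
      using assms(10)[OF i(1)] i(2) by (auto simp: H_def)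
    then have "H z = pencil (vector [r1, r2, r3])" by (simp add: pencil_def vector_3)
    then show ?thesis ..
  qed
  \<comment> \<open>The three matrices may be linearly dependent, so coefficients are merely chosen
    at the vertices; \<open>R\<close> is the hull of these choices.\<close>
  then obtain r where r: "\<And>z. z \<in> V \<Longrightarrow> H z = pencil (r z)" by metis
  define R where "R = convex hull (r ` V)"
  have R: "convex R" "compact R"
    by (auto simp: R_def V_def intro: finite_imp_compact_convex_hull)
  obtain s1 s2 s3 where pd: "positive_definite (s1 *\<^sub>R A1 + s2 *\<^sub>R A2 + s3 *\<^sub>R A3)"
    using assms(11) by blast
  have W: "convex (?Q ` S)" "cone (?Q ` S)"
    using convex_cone_quad_map_range[OF assms(7-9) pd S] .
  have "\<exists>c\<in>R. 0 \<le> c \<bullet> w" if w: "w \<in> ?Q ` S" for w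
  proof -
    obtain v where v: "v \<in> S" "w = ?Q v" using w by blast
    \<comment> \<open>For fixed \<open>v\<close> the value is affine in the multiplier, so
      negativity at all vertices would spread to all of \<open>?\<Lambda>\<close>.\<close>
    have "\<exists>z\<in>V. 0 \<le> quad_form (H z) v"
    proof (rule ccontr)
      assume "\<not> ?thesis"
      then have "V \<subseteq> {z. quad_form (H z) v < 0}" by force
      moreover have "convex {z. quad_form (H z) v < 0}"
      proof (rule convexI)
        fix y z and a b :: real
        assume yz: "y \<in> {z. quad_form (H z) v < 0}" "z \<in> {z. quad_form (H z) v < 0}"
          and ab: "0 \<le> a" "0 \<le> b" "a + b = 1"
        have "a * quad_form (H y) v + b * quad_form (H z) v < 0"
          using yz ab convex_bound_lt[of "quad_form (H y) v" 0 "quad_form (H z) v" a b] by simp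
        then show "a *\<^sub>R y + b *\<^sub>R z \<in> {z. quad_form (H z) v < 0}"
          by (simp add: H_affine[OF ab(3)] quad_form_add_matrix quad_form_scale_matrix)
      qed
      ultimately have "?\<Lambda> \<subseteq> {z. quad_form (H z) v < 0}" unfolding \<Lambda> by (rule hull_minimal)
      then show False using nonneg[OF v(1)] by force
    qed
    then obtain z where z: "z \<in> V" "0 \<le> quad_form (H z) v" by blast
    then have "0 \<le> r z \<bullet> w" by (simp add: v(2) inner_quad_map r pencil_def)
    moreover have "r z \<in> R" using z(1) by (simp add: R_def hull_inc)
    ultimately show ?thesis by blast
  qed
  moreover have "?Q ` S \<noteq> {}" using subspace_0[OF S(1)] by blast
  ultimately obtain c where c: "c \<in> R" "\<And>w. w \<in> ?Q ` S \<Longrightarrow> 0 \<le> c \<bullet> w"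
    using compact_convex_cone_minimax[OF R W] by blast
  \<comment> \<open>Returning from coefficients to multipliers: the vectors realized by some
    multiplier form a convex set containing the chosen ones.\<close>
  have "R \<subseteq> {c. \<exists>z\<in>?\<Lambda>. H z = pencil c}"
    unfolding R_def
  proof (rule hull_minimal)
    show "r ` V \<subseteq> {c. \<exists>z\<in>?\<Lambda>. H z = pencil c}" using r hull_inc[of _ V convex] unfolding \<Lambda> by blast
    show "convex {c. \<exists>z\<in>?\<Lambda>. H z = pencil c}"
    proof (rule convexI)
      fix c c' and a b :: real
      assume "c \<in> {c. \<exists>z\<in>?\<Lambda>. H z = pencil c}" "c' \<in> {c. \<exists>z\<in>?\<Lambda>. H z = pencil c}"
        and ab: "0 \<le> a" "0 \<le> b" "a + b = 1"
      then obtain z z' where "z \<in> ?\<Lambda>" "H z = pencil c" "z' \<in> ?\<Lambda>" "H z' = pencil c'" by blast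
      then have "a *\<^sub>R z + b *\<^sub>R z' \<in> ?\<Lambda>" "H (a *\<^sub>R z + b *\<^sub>R z') = pencil (a *\<^sub>R c + b *\<^sub>R c')"
        using ab convex by (auto simp: H_affine pencil_affine convexD)
      then show "a *\<^sub>R c + b *\<^sub>R c' \<in> {c. \<exists>z\<in>?\<Lambda>. H z = pencil c}" by blast
    qed
  qed
  then obtain z where z: "z \<in> ?\<Lambda>" "H z = pencil c" using c(1) by blast
  have "0 \<le> quad_form (H z) v" if "v \<in> K" for v
    using c(2)[of "?Q v"] that z(2) by (simp add: S_def inner_quad_map pencil_def)
  then show "\<exists>(l, u) \<in> ?\<Lambda>. \<forall>v\<in>K. v \<bullet> (hessian (lagrangian f g h P Q l u) xs *v v) \<ge> 0"
    using z(1) by (intro bexI[of _ z]) (auto simp: H_def quad_form_def split: prod.split)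
qed

end
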